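(* Suppose that a pattern $p$ uses $r$ distinct variables, where the $j$th variable occurs $k_j\ge 1$ times. Without loss of generality, let $k=|p|=k_1+\cdots+k_r$ and $1=k_1=\cdots=k_s<k_{s+1}\le\cdots\le k_r$. Then the mean number of occurrences of $p$ in a partial word of length $n$ with hole density $d\in\mathbb Q\cap(0,1)$ over an alphabet of $m$ letters is $$\widehat{\Omega}_{n,d}\sim\frac{n^{s+1}}{(s+1)!}\prod_{j=s+1}^r\frac{[1+d(m-1)]^{k_j}-\left(1-\frac1m\right)(md)^{k_j}}{m^{k_j-1}-[1+d(m-1)]^{k_j}+\left(1-\frac1m\right)(md)^{k_j}}.$$
   Context: A partial word over an alphabet $\mathcal A$ is a sequence of characters from $\mathcal A\cup\{\diamond\}$, where $\diamond\notin\mathcal A$ is the hole character; its hole density is the ratio of its number of holes to its length. Two partial words $u=u_1\cdots u_N$ and $v=v_1\cdots v_N$ of equal length are compatible, written $u\uparrow v$, if $u_i=v_i$ whenever $u_i,v_i\in\mathcal A$. A pattern is a word $p$ over an alphabet $\mathcal V$ of variables, and $|p|$ is its length; a morphism $h:\mathcal V^*\to\mathcal A^*$ is nonerasing if $h(v)$ is nonempty for every $v\in\mathcal V$. A factor is a contiguous block. Occurrences are counted as follows: a partial word $w$ over $\mathcal A$ encounters $p$ a total of $N>0$ times if, for some maximal $M>0$, there exist $M$ distinct nonerasing morphisms $h_i:\mathcal V^*\to\mathcal A^*$ such that for some $t_1,\ldots,t_M>0$ there are $t_i>0$ factors $f_i$ of $w$ that satisfy $f_i\uparrow h_i(p)$,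 and $\sum_{i=1}^M t_i=N$ (factors are counted by position in $w$). The mean is over all $\binom{n}{h}m^{n-h}$ partial words of length $n$ with $h=dn$ holes over an alphabet $\mathcal A$ of $m$ letters. The notation $\sim$ means that the ratio of the two sides tends to $1$ as $n\to\infty$ (through $n$ for which $dn$ is an integer). Empty products equal $1$.
   Formalization: Occurrences are counted by position and block lengths: morphisms differing only in letters matched to all-hole columns count once (counting each morphism makes the claim false, e.g. p=x, m=2). If s<r, m≥2 is assumed, since for m=1 the denominators vanish. *)

theory Defs
  imports Complex_Main "HOL-Library.Landau_Symbols" "HOL-Library.FuncSet" "HOL-Library.Cardinality"
begin

(* A partial word over the alphabet 'a; None is the hole character. *)
type_synonym 'a pword = "'a option list"

definition holes :: "'a pword \<Rightarrow> nat" where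
  "holes w = count_list w None"

definition hole_density :: "'a pword \<Rightarrow> real" where
  "hole_density w = real (holes w) / real (length w)"

definition compatible :: "'a pword \<Rightarrow> 'a pword \<Rightarrow> bool" (infix "\<up>" 50) where
  "u \<up> v \<longleftrightarrow> length u = length v \<and>
     (\<forall>i<length u. u ! i \<noteq> None \<and> v ! i \<noteq> None \<longrightarrow> u ! i = v ! i)"

definition factor_at :: "'a pword \<Rightarrow> nat \<Rightarrow> nat \<Rightarrow> 'a pword" where
  "factor_at w i l = take l (drop i w)"

(* The variable alphabet of a pattern p is the set of variables it uses.  Extensionality makes
   two morphisms distinct exactly if they differ on one of these variables. *)
definition nonerasing_morphisms :: "'v list \<Rightarrow> ('v \<Rightarrow> 'a list) set" where
  "nonerasing_morphisms p = set p \<rightarrow>\<^sub>E {u. u \<noteq> []}"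

definition morph :: "('v \<Rightarrow> 'a list) \<Rightarrow> 'v list \<Rightarrow> 'a list" where
  "morph h p = concat (map h p)"

definition encounters :: "'v list \<Rightarrow> 'a pword \<Rightarrow> (nat \<times> ('v \<Rightarrow> 'a list)) set" where
  "encounters p w = {(i, h). h \<in> nonerasing_morphisms p \<and>
     i + length (morph h p) \<le> length w \<and>
     factor_at w i (length (morph h p)) \<up> map Some (morph h p)}"

(* An occurrence is a factor of w, given by its position, together with its division into the
   blocks matched by the successive variables of p.  If all the blocks matched by a variable have
   holes at a common index, several morphisms fit the same divided factor; such encounters are the
   same occurrence. *)
definition occurrences :: "'v list \<Rightarrow> 'a pword \<Rightarrow> (nat \<times> nat list) set" where
  "occurrences p w = (\<lambda>(i, h). (i, map (\<lambda>v. length (h v)) p)) ` encounters p w"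

definition pwords :: "nat \<Rightarrow> real \<Rightarrow> 'a::finite pword set" where
  "pwords n d = {w. length w = n \<and> hole_density w = d}"

definition mean_occurrences :: "'a::finite itself \<Rightarrow> 'v list \<Rightarrow> nat \<Rightarrow> real \<Rightarrow> real" where
  "mean_occurrences _ p n d =
     (\<Sum>w\<in>(pwords n d :: 'a pword set). real (card (occurrences p w)))
       / real (card (pwords n d :: 'a pword set))"

lemma card_words_holes:
  "card {w :: 'a::finite pword. length w = n \<and> holes w = h} = (n choose h) * CARD('a) ^ (n - h)"
proof (induction n arbitrary: h)
  case 0
  have "{w :: 'a pword. length w = 0 \<and> holes w = h} = (if h = 0 then {[]} else {})"
    by (auto simp: holes_def)
  then show ?case by (cases h) auto
next
  case (Suc n)
  let ?W = "\<lambda>n h. {w :: 'a pword. length w = n \<and> holes w = h}"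
  have fin: "finite (?W n h)" for n h
    by (rule finite_subset[OF _ finite_lists_length_eq[OF finite[of UNIV], of n]]) auto
  have letters: "card ((\<lambda>(a, w). Some a # w) ` (UNIV \<times> ?W n h)) = CARD('a) * card (?W n h)"
    by (subst card_image) (auto simp: inj_on_def card_cartesian_product)
  show ?case
  proof (cases h)
    case 0
    have "?W (Suc n) h = (\<lambda>(a, w). Some a # w) ` (UNIV \<times> ?W n h)"
      unfolding 0 by (rule set_eqI) (case_tac x; case_tac "hd x"; auto simp: holes_def image_iff)
    then show ?thesis using letters Suc.IH[of h] 0 by simp
  next
    case h: (Suc g)
    have eq: "?W (Suc n) h = (\<lambda>(a, w). Some a # w) ` (UNIV \<times> ?W n h) \<union> (#) None ` ?W n g"
      unfolding h by (rule set_eqI) (case_tac x; case_tac "hd x"; auto simp: holes_def image_iff)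
    have "card (?W (Suc n) h) = CARD('a) * card (?W n h) + card (?W n g)"
      unfolding eq using letters fin
      by (subst card_Un_disjoint) (auto simp: card_image)
    also have "\<dots> = (Suc n choose h) * CARD('a) ^ (Suc n - h)"
    proof (cases "h \<le> n")
      case True
      then have "CARD('a) * CARD('a) ^ (n - h) = CARD('a) ^ (n - g)"
        using h by (metis Suc_diff_Suc Suc_le_lessD power_Suc)
      then show ?thesis using Suc.IH[of h] Suc.IH[of g] h by (simp add: algebra_simps)
    next
      case False
      then show ?thesis using Suc.IH[of h] Suc.IH[of g] h by simp
    qed
    finally show ?thesis .
  qed
qed

lemma card_pwords:
  assumes "n > 0" and "real h = d * real n"
  shows "card (pwords n d :: 'a::finite pword set) = (n choose h) * CARD('a) ^ (n - h)"
proof -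
  have "(pwords n d :: 'a pword set) = {w. length w = n \<and> holes w = h}"
    using assms by (auto simp: pwords_def hole_density_def field_simps)
  then show ?thesis by (simp add: card_words_holes)
qed

(* In full words, occurrences are just pairs of a position and a morphism. *)
lemma card_occurrences_full_word:
  assumes full: "None \<notin> set w"
  shows "card (occurrences p w) = card (encounters p w)"
proof -
  have inj: "g = h"
    if g: "(i, g) \<in> encounters p w" and h: "(i, h) \<in> encounters p w"
      and lens: "\<forall>v\<in>set p. length (g v) = length (h v)" for i g h
  proof -
    have len: "map (\<lambda>v. length (g v)) p = map (\<lambda>v. length (h v)) p"
      using lens by simp
    have eq: "factor_at w i (length (morph f p)) = map Some (morph f p)"
      if "(i, f) \<in> encounters p w" for i f
    proof (rule nth_equalityI)
      show "length (factor_at w i (length (morph f p))) = length (map Some (morph f p))"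
        using that by (auto simp: encounters_def compatible_def)
      fix k assume k: "k < length (factor_at w i (length (morph f p)))"
      have "factor_at w i (length (morph f p)) ! k \<in> set w"
        using nth_mem[OF k] by (auto simp: factor_at_def dest: in_set_takeD in_set_dropD)
      with full have "factor_at w i (length (morph f p)) ! k \<noteq> None" by metis
      with that k show "factor_at w i (length (morph f p)) ! k = map Some (morph f p) ! k"
        by (auto simp: encounters_def compatible_def)
    qed
    have L: "length (morph g p) = length (morph h p)"
      using arg_cong[OF len, of sum_list] by (simp add: morph_def length_concat o_def)
    have "map Some (morph g p) = map Some (morph h p)"
      using trans[OF eq[OF g, symmetric]] eq[OF h] unfolding L by metis
    then have c: "concat (map g p) = concat (map h p)"
      unfolding morph_def by (rule map_injective) auto
    have "map g p = map h p"
      using c len by (induction p) auto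
    then have "\<forall>v\<in>set p. g v = h v" by simp
    moreover have "g \<in> extensional (set p)" "h \<in> extensional (set p)"
      using g h by (auto simp: encounters_def nonerasing_morphisms_def PiE_def)
    ultimately show "g = h" by (meson extensionalityI)
  qed
  have "inj_on (\<lambda>(i, h). (i, map (\<lambda>v. length (h v)) p)) (encounters p w)"
    by (auto simp: inj_on_def intro: inj)
  then show ?thesis by (simp add: occurrences_def card_image)
qed

(* With holes, counting the morphisms of each factor separately would not do: already the
   one-letter pattern would be counted exponentially often in every partial word. *)
lemma card_encounters_single_variable:
  fixes w :: "'a::finite pword"
  assumes "w \<noteq> []"
  shows "CARD('a) ^ holes w \<le> card (encounters [x] w)"
proof -
  define F where "F w = {u. list_all2 (\<lambda>a b. a = None \<or> a = Some b) w u}" for w :: "'a pword"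
  have fin: "finite (F w)" for w
    by (rule finite_subset[OF _ finite_lists_length_eq[OF finite[of UNIV], of "length w"]])
      (auto simp: F_def list_all2_lengthD)
  have card_F: "card (F w) = CARD('a) ^ holes w" for w
  proof (induction w)
    case Nil
    have "F [] = {[]}" by (auto simp: F_def)
    then show ?case by (simp add: holes_def)
  next
    case (Cons a w)
    have "F (a # w) = (\<lambda>(b, u). b # u) ` ((case a of None \<Rightarrow> UNIV | Some b \<Rightarrow> {b}) \<times> F w)"
      by (auto simp: F_def list_all2_Cons1 image_iff split: option.splits)
    moreover have "inj_on (\<lambda>(b, u). b # u) ((case a of None \<Rightarrow> UNIV | Some b \<Rightarrow> {b}) \<times> F w)"
      by (auto simp: inj_on_def)
    ultimately have "card (F (a # w)) = card (case a of None \<Rightarrow> UNIV | Some b \<Rightarrow> {b}) * card (F w)"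
      by (simp add: card_image card_cartesian_product)
    then show ?case using Cons by (cases a) (auto simp: holes_def)
  qed
  define e where "e u = (0 :: nat, \<lambda>v \<in> {x}. u)" for u :: "'a list"
  have inj: "inj_on e (F w)"
    by (rule inj_onI) (metis e_def prod.inject restrict_apply' singletonI)
  have sub: "e ` F w \<subseteq> encounters [x] w"
  proof (rule image_subsetI)
    fix u assume "u \<in> F w"
    then have "length w = length u" "\<forall>i<length w. w ! i = None \<or> w ! i = Some (u ! i)"
      by (auto simp: F_def list_all2_conv_all_nth)
    with assms show "e u \<in> encounters [x] w"
      by (auto simp: e_def encounters_def nonerasing_morphisms_def morph_def factor_at_def
          compatible_def)
  qed
  have "encounters [x] w \<subseteq> {..length w} \<times> ({x} \<rightarrow>\<^sub>E {u. set u \<subseteq> UNIV \<and> length u \<le> length w})"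
    by (auto simp: encounters_def nonerasing_morphisms_def morph_def PiE_iff extensional_def)
  moreover have "finite \<dots>"
    by (intro finite_cartesian_product finite_PiE finite_lists_length_le) auto
  ultimately have "finite (encounters [x] w)"
    by (rule finite_subset)
  from card_mono[OF this sub] show ?thesis
    by (simp add: card_image[OF inj] card_F)
qed

end

theory Submission
  imports Defs "HOL-Analysis.Analysis" "HOL-Real_Asymp.Real_Asymp"
begin

text \<open>
  An occurrence is a position together with a length for each variable. The positions carrying the
  same index in the blocks of a variable form a class, and a word fits iff every class contains at
  most one letter besides holes. Counted by holes, the fillings of a class of size \<open>k\<close> have the
  generating polynomial \<open>m (1 + X)^k - (m - 1) X^k\<close>, which is \<open>X + m\<close> for \<open>k = 1\<close>; so the number of
  words that fit depends only on the lengths of the repeated variables. Summing over the position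
  and the lengths of the \<open>s\<close> other variables contributes a binomial coefficient
  \<open>\<sim> n^(s + 1) / (s + 1)!\<close>. For fixed lengths the probability of fitting converges to its value for
  independent holes of density \<open>d\<close>, a product of powers of numbers \<open>q < 1\<close>, and dominated convergence
  leaves the product of the geometric series \<open>q / (1 - q)\<close>.
\<close>

subsection \<open>Infinite sums\<close>

text \<open>The obstacle is the dominating series. With the number of holes fixed, characters at
  different positions are dependent, and the hypergeometric probability of a hole pattern on
  \<open>T\<close> positions is bounded by \<open>(D / (D - 1)) ^ T\<close> times the independent
  one only while \<open>D * T \<le> n\<close>. Divisions that cover a larger part of the word escape
  this. They are handled by comparing generating polynomials coefficientwise:
  \<open>class_poly m k\<close> lies below \<open>(X + m) ^ k\<close>, so dissolving classes into
  free positions can only raise the probability, and each repeated length \<open>l\<close> may be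
  replaced by \<open>l div D\<close>. The price is a decay of \<open>q' ^ (l div D)\<close> with the
  inflated rate \<open>q' = (D / (D - 1)) ^ k * q\<close>. Since \<open>q < 1\<close> strictly, a
  large \<open>D\<close> keeps the finitely many \<open>q'\<close> below 1, and the series
  converges. The rate \<open>q\<close> is the probability that \<open>k\<close> independent
  characters, each a hole with probability \<open>d\<close> and otherwise a uniform letter, agree up
  to holes; \<open>m ^ (k - 1) * q\<close> is the numerator in the theorem. For
  \<open>k \<ge> 2\<close>, having \<open>q < 1\<close> takes at least two letters.\<close>

lemma tendsto_infsum_dominated:
  fixes a :: "'k \<Rightarrow> 'n \<Rightarrow> 'a::banach"
  assumes lim: "\<And>k. k \<in> A \<Longrightarrow> ((\<lambda>n. a k n) \<longlongrightarrow> b k) F"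
    and bound: "\<forall>\<^sub>F n in F. \<forall>k\<in>A. norm (a k n) \<le> M k"
    and M: "M summable_on A"
  shows "((\<lambda>n. \<Sum>\<^sub>\<infinity>k\<in>A. a k n) \<longlongrightarrow> (\<Sum>\<^sub>\<infinity>k\<in>A. b k)) F"
proof (cases "F = bot")
  case False
  have "norm (b k) \<le> M k" if "k \<in> A" for k
  proof (rule tendsto_upperbound)
    show "((\<lambda>n. norm (a k n)) \<longlongrightarrow> norm (b k)) F"
      by (intro tendsto_norm lim that)
    show "\<forall>\<^sub>F n in F. norm (a k n) \<le> M k"
      using bound by eventually_elim (use that in auto)
  qed (use False in auto)
  then have "(\<lambda>k. norm (b k)) summable_on A"
    by (intro Infinite_Sum.abs_summable_on_comparison_test'[OF M])
  then have b: "b summable_on A"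
    by (rule abs_summable_summable)
  \<comment> \<open>Tannery's argument: over the \<open>n\<close> that satisfy the bound, the
    Weierstrass test makes the finite partial sums converge uniformly, so the two limits can be
    exchanged. A bound that holds only eventually is therefore enough.\<close>
  show ?thesis
  proof (rule swap_uniform_limit')
    show "((\<lambda>K. \<Sum>k\<in>K. b k) \<longlongrightarrow> (\<Sum>\<^sub>\<infinity>k\<in>A. b k)) (finite_subsets_at_top A)"
      using b by (simp add: has_sum_def[symmetric])
    show "\<forall>\<^sub>F K in finite_subsets_at_top A. ((\<lambda>n. \<Sum>k\<in>K. a k n) \<longlongrightarrow> (\<Sum>k\<in>K. b k)) F"
      by (rule eventually_finite_subsets_at_top_weakI) (auto intro!: tendsto_sum lim)
    show "\<forall>\<^sub>F n in F. n \<in> {n. \<forall>k\<in>A. norm (a k n) \<le> M k}"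
      using bound by simp
    show "uniform_limit {n. \<forall>k\<in>A. norm (a k n) \<le> M k} (\<lambda>K n. \<Sum>k\<in>K. a k n)
        (\<lambda>n. \<Sum>\<^sub>\<infinity>k\<in>A. a k n) (finite_subsets_at_top A)"
      by (rule Weierstrass_m_test_general[OF _ M]) auto
  qed auto
qed simp

text \<open>Nonnegativity identifies summability with absolute summability, for which the product
  rule is available in \<open>Infinite_Set_Sum\<close>.\<close>

lemma summable_on_prod_PiE:
  fixes f :: "'v \<Rightarrow> nat \<Rightarrow> real"
  assumes "finite V" "\<And>v. v \<in> V \<Longrightarrow> f v summable_on B v" "\<And>v l. 0 \<le> f v l"
  shows "(\<lambda>M. \<Prod>v\<in>V. f v (M v)) summable_on (Pi\<^sub>E V B)"
proof -
  have "Infinite_Set_Sum.abs_summable_on (\<lambda>M. \<Prod>v\<in>V. f v (M v)) (Pi\<^sub>E V B)"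
    using assms by (intro abs_summable_on_prod_PiE) (auto simp flip: abs_summable_equivalent)
  then show ?thesis
    by (simp flip: abs_summable_equivalent add: assms prod_nonneg)
qed

text \<open>The sum starts at 1 because blocks are nonempty.\<close>

lemma has_sum_geometric_from_1:
  fixes q :: real
  assumes "0 \<le> q" "q < 1"
  shows "((\<lambda>l. q ^ l) has_sum (q / (1 - q))) {1..}"
proof -
  have "(\<lambda>n. q ^ n) sums (1 / (1 - q))"
    using assms by (intro geometric_sums) auto
  then have "((\<lambda>n. q ^ n) has_sum (1 / (1 - q))) UNIV"
    using assms by (intro sums_nonneg_imp_has_sum) auto
  then have "((\<lambda>n. q * q ^ n) has_sum (q * (1 / (1 - q)))) UNIV"
    by (rule has_sum_cmult_right)
  then have "((\<lambda>l. q ^ l) has_sum (q / (1 - q))) (range Suc)"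
    by (simp add: has_sum_reindex o_def)
  moreover have "range Suc = {1..}" by (auto simp: image_iff) presburger
  ultimately show ?thesis by simp
qed

lemma summable_on_power_div:
  fixes q :: real
  assumes "0 < q" "q < 1" "0 < D"
  shows "(\<lambda>l. q ^ (l div D)) summable_on {1..}"
proof -
  \<comment> \<open>The \<open>D\<close>-th root spreads one step of \<open>l div D\<close> over
    \<open>D\<close> steps of \<open>l\<close>. The remainder \<open>l mod D\<close> costs at most a
    factor \<open>1 / q\<close>, which leaves an ordinary geometric series.\<close>
  define t where "t = root D q"
  have t: "0 < t" "t < 1" "t ^ D = q"
    using assms by (auto simp: t_def)
  have le: "q ^ (l div D) \<le> t ^ l / q" for l
  proof -
    have "q ^ (l div D) * q \<le> q ^ (l div D) * t ^ (l mod D)"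
    proof (rule mult_left_mono)
      have "t ^ D \<le> t ^ (l mod D)"
        using t(1,2) assms(3) by (intro power_decreasing) (auto simp: less_imp_le)
      then show "q \<le> t ^ (l mod D)" using t(3) by simp
    qed (use assms in simp)
    also have "\<dots> = t ^ (D * (l div D) + l mod D)"
      by (metis power_add power_mult t(3))
    finally show ?thesis using assms by (simp add: field_simps)
  qed
  have "(\<lambda>l. t ^ l / q) summable_on {1..}"
    unfolding divide_inverse
    by (intro summable_on_cmult_left has_sum_imp_summable[OF has_sum_geometric_from_1]) (use t in auto)
  then show ?thesis
    by (rule summable_on_comparison_test) (use le assms in auto)
qed

lemma infsum_prod_geometric:
  fixes q :: "'v \<Rightarrow> real"
  assumes "finite V" "\<And>v. v \<in> V \<Longrightarrow> 0 \<le> q v \<and> q v < 1"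
  shows "(\<Sum>\<^sub>\<infinity>M\<in>V \<rightarrow>\<^sub>E {1..}. \<Prod>v\<in>V. q v ^ M v) = (\<Prod>v\<in>V. q v / (1 - q v))"
proof -
  have hs: "((\<lambda>l. q v ^ l) has_sum (q v / (1 - q v))) {1..}" if "v \<in> V" for v
    using assms that by (intro has_sum_geometric_from_1) auto
  have "(\<Sum>\<^sub>\<infinity>M\<in>V \<rightarrow>\<^sub>E {1..}. \<Prod>v\<in>V. q v ^ M v) = (\<Prod>v\<in>V. \<Sum>\<^sub>\<infinity>l\<in>{1..}. q v ^ l)"
    using assms hs by (intro infsum_prod_PiE_abs) (auto dest: has_sum_imp_summable)
  also have "\<dots> = (\<Prod>v\<in>V. q v / (1 - q v))"
    using hs by (intro prod.cong) (auto dest: infsumI)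
  finally show ?thesis .
qed

subsection \<open>The generating polynomial of a class of positions\<close>

text \<open>Choosing the common letter in \<open>m\<close> ways gives \<open>m (1 + X) ^ k\<close>,
  where the filling by holes alone is counted \<open>m\<close> times instead of once. The subtracted
  monomial corrects this.\<close>

definition class_poly :: "nat \<Rightarrow> nat \<Rightarrow> real poly" where
  "class_poly m k = smult (real m) ([:1, 1:] ^ k) - monom (real m - 1) k"

lemma class_poly_1: "class_poly m (Suc 0) = [:real m, 1:]"
  by (simp add: class_poly_def monom_altdef)

lemma coeff_class_poly:
  "coeff (class_poly m k) a = (if a = k then 1 else real m * real (k choose a))"
proof (cases "a \<le> k")
  case True
  then show ?thesis
    by (simp add: class_poly_def coeff_linear_poly_power)
next
  case False
  then have "coeff ([:1, 1:] ^ k) a = (0 :: real)"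
    by (intro coeff_eq_0) (auto simp: degree_linear_power)
  with False show ?thesis by (simp add: class_poly_def binomial_eq_0)
qed

lemma degree_class_poly: "degree (class_poly m k) \<le> k"
  by (rule degree_le) (simp add: coeff_class_poly binomial_eq_0)

lemma poly_class_poly: "poly (class_poly m k) y = real m * (1 + y) ^ k - (real m - 1) * y ^ k"
  by (simp add: class_poly_def poly_monom)

lemma coeff_linear_poly_power_if:
  "coeff ([:c, 1:] ^ n) i = (if i \<le> n then real (n choose i) * c ^ (n - i) else 0)"
proof (cases "i \<le> n")
  case False
  then show ?thesis by (intro trans[OF coeff_eq_0]) (auto simp: degree_linear_power)
qed (simp add: coeff_linear_poly_power)

section \<open>Coefficientwise comparison of polynomials\<close>

definition coeffs_le :: "real poly \<Rightarrow> real poly \<Rightarrow> bool" where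
  "coeffs_le A B \<longleftrightarrow> (\<forall>i. 0 \<le> coeff A i \<and> coeff A i \<le> coeff B i)"

text \<open>Nonnegativity, built into the relation, is what lets the inequalities pass through the
  convolution. In the same way \<open>coeffs_le A A\<close> expresses that \<open>A\<close> has
  nonnegative coefficients.\<close>

lemma coeffs_le_mult: "coeffs_le A B \<Longrightarrow> coeffs_le C D \<Longrightarrow> coeffs_le (A * C) (B * D)"
  unfolding coeffs_le_def coeff_mult
  by (auto intro!: sum_nonneg sum_mono mult_mono intro: order_trans)

lemma coeffs_le_1: "coeffs_le 1 1"
  by (simp add: coeffs_le_def)

lemma coeffs_le_power: "coeffs_le A B \<Longrightarrow> coeffs_le (A ^ n) (B ^ n)"
  by (induction n) (auto intro: coeffs_le_mult coeffs_le_1)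

lemma coeffs_le_prod:
  "(\<And>v. v \<in> V \<Longrightarrow> coeffs_le (f v) (g v)) \<Longrightarrow> coeffs_le (prod f V) (prod g V)"
  by (induction V rule: infinite_finite_induct) (auto intro: coeffs_le_mult coeffs_le_1)

text \<open>The right side counts all fillings of \<open>k\<close> positions, so this drops the
  constraint on one class. Numerically it is \<open>m \<le> m ^ (k - i)\<close> for
  \<open>i < k\<close>.\<close>

lemma coeffs_le_class_poly:
  assumes "1 \<le> m"
  shows "coeffs_le (class_poly m k) ([:real m, 1:] ^ k)"
  unfolding coeffs_le_def coeff_class_poly coeff_linear_poly_power_if
proof (intro allI conjI)
  fix i
  have "real m * real (k choose i) \<le> real (k choose i) * real m ^ (k - i)" if "i < k"
    using assms that self_le_power[of "real m" "k - i"] by (simp add: mult.commute mult_left_mono)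
  then show "(if i = k then 1 else real m * real (k choose i))
      \<le> (if i \<le> k then real (k choose i) * real m ^ (k - i) else 0)"
    by (auto simp: binomial_eq_0)
qed auto

lemma coeffs_le_refl: "coeffs_le A B \<Longrightarrow> coeffs_le A A"
  by (simp add: coeffs_le_def)

subsection \<open>Hypergeometric ratios\<close>

lemma prod_diff_fact:
  "(\<Prod>i<a. real h - real i) = (if a \<le> h then fact h / fact (h - a) else 0)"
proof (cases "a \<le> h")
  case True
  then have "(\<Prod>i<a. real h - real i) = fact a * real (h choose a)"
    by (simp add: binomial_gbinomial gbinomial_prod_rev lessThan_atLeast0)
  then show ?thesis using True by (simp add: binomial_fact)
next
  case False
  then show ?thesis by (auto intro!: prod_zero bexI[of _ h])
qed

text \<open>A quotient of falling factorials: the probability that a random set of \<open>h\<close>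
  out of \<open>n\<close> positions meets \<open>T\<close> given positions in a prescribed subset of
  size \<open>a\<close>. The choice of that subset is accounted for by the coefficients of the
  generating polynomial.\<close>

definition hyp_ratio :: "nat \<Rightarrow> nat \<Rightarrow> nat \<Rightarrow> nat \<Rightarrow> real" where
  "hyp_ratio n h T a =
    (\<Prod>i<a. real h - real i) * (\<Prod>i<T - a. real n - real h - real i) / (\<Prod>i<T. real n - real i)"

lemma hyp_ratio_choose:
  assumes "a \<le> T" "T \<le> n" "h \<le> n"
  shows "(if a \<le> h then real ((n - T) choose (h - a)) else 0) = real (n choose h) * hyp_ratio n h T a"
proof -
  have *: "real n - real h = real (n - h)" using assms by simp
  \<comment> \<open>For \<open>h < a\<close> the conditional keeps the truncated
    \<open>h - a\<close> from yielding a spurious 1, and the product over \<open>i < a\<close>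
    vanishes. In the second case \<open>h - a > n - T\<close> means \<open>T - a > n - h\<close>, so
    the other product in the numerator vanishes.\<close>
  consider "h < a" | "a \<le> h" "n - T < h - a" | "a \<le> h" "h - a \<le> n - T" by linarith
  then show ?thesis
  proof cases
    case 1
    then show ?thesis by (simp add: hyp_ratio_def prod_diff_fact)
  next
    case 2
    then have "\<not> T - a \<le> n - h" using assms by linarith
    with 2 show ?thesis unfolding hyp_ratio_def * prod_diff_fact by (simp add: binomial_eq_0)
  next
    case 3
    then have "T - a \<le> n - h" and e: "n - h - (T - a) = n - T - (h - a)" using assms by linarith+
    with 3 assms show ?thesis unfolding hyp_ratio_def * prod_diff_fact
      by (simp add: binomial_fact e)
  qed
qed

text \<open>The index \<open>a\<close> is the number of holes among the \<open>T\<close> constrained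
  positions. The \<open>n - h\<close> letters split into those on free positions and
  \<open>T - a\<close> others, which explains the power of \<open>m\<close> left in the
  denominator.\<close>

lemma coeff_mult_linear_power:
  fixes A :: "real poly"
  assumes "degree A \<le> T" "T \<le> n" "h \<le> n" "1 \<le> m"
  shows "coeff (A * [:real m, 1:] ^ (n - T)) h / (real (n choose h) * real m ^ (n - h)) =
    (\<Sum>a\<le>T. coeff A a / real m ^ (T - a) * hyp_ratio n h T a)"
proof -
  let ?N = "real (n choose h) * real m ^ (n - h)"
  let ?B = "\<lambda>b. coeff ([:real m, 1:] ^ (n - T)) b"
  have N: "?N > 0" using assms by simp
  have "coeff (A * [:real m, 1:] ^ (n - T)) h / ?N = (\<Sum>a\<le>h. coeff A a * ?B (h - a)) / ?N"
    by (simp add: coeff_mult)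
  \<comment> \<open>The convolution runs over \<open>a \<le> h\<close>, the claim over
    \<open>a \<le> T\<close>; both ranges are extended by zeros to \<open>max h T\<close>.\<close>
  also have "(\<Sum>a\<le>h. coeff A a * ?B (h - a))
      = (\<Sum>a\<le>max h T. coeff A a * (if a \<le> h then ?B (h - a) else 0))"
    by (intro sum.mono_neutral_cong_left) auto
  also have "\<dots> = (\<Sum>a\<le>T. coeff A a * (if a \<le> h then ?B (h - a) else 0))"
    using assms(1) by (intro sum.mono_neutral_cong_right) (auto simp: coeff_eq_0)
  also have "\<dots> / ?N = (\<Sum>a\<le>T. coeff A a / real m ^ (T - a) * hyp_ratio n h T a)"
    unfolding sum_divide_distrib
  proof (intro sum.cong refl)
    fix a assume "a \<in> {..T}"
    then have a: "a \<le> T" by simp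
    have "(if a \<le> h then ?B (h - a) else 0) =
      (if a \<le> h then real ((n - T) choose (h - a)) else 0) * (real m ^ (n - h) / real m ^ (T - a))"
    proof (cases "a \<le> h \<and> h - a \<le> n - T")
      case True
      then have "n - h = (n - T - (h - a)) + (T - a)" using a assms by linarith
      then have "real m ^ (n - h) = real m ^ (n - T - (h - a)) * real m ^ (T - a)"
        by (metis power_add)
      with True show ?thesis using assms by (simp add: coeff_linear_poly_power_if)
    qed (auto simp: coeff_linear_poly_power_if binomial_eq_0)
    then show "coeff A a * (if a \<le> h then ?B (h - a) else 0) / ?N =
        coeff A a / real m ^ (T - a) * hyp_ratio n h T a"
      unfolding hyp_ratio_choose[OF a assms(2,3)] using assms by simp
  qed
  finally show ?thesis .
qed

text \<open>In the numerator each factor is compared with \<open>h\<close> or \<open>n - h\<close>.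
  In the denominator \<open>i < T \<le> n / D\<close>, so each factor is at least
  \<open>n (1 - 1 / D)\<close>.\<close>

lemma hyp_ratio_le:
  fixes D n :: nat
  assumes "2 \<le> D" "D * T \<le> n" "a \<le> T" "real h = d * real n" "0 \<le> d" "d \<le> 1" "0 < n"
  shows "hyp_ratio n h T a \<le> (real D / (real D - 1)) ^ T * (d ^ a * (1 - d) ^ (T - a))"
proof -
  have hn: "real h \<le> real n" using assms by (simp add: mult_left_le_one_le)
  have pow: "(\<Prod>i<b. real c - real i) \<le> real c ^ b" and nonneg: "0 \<le> (\<Prod>i<b. real c - real i)" for b c :: nat
  proof -
    show "0 \<le> (\<Prod>i<b. real c - real i)" by (simp add: prod_diff_fact)
    show "(\<Prod>i<b. real c - real i) \<le> real c ^ b"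
    proof (cases "b \<le> c")
      case True
      then have "(\<Prod>i<b. real c - real i) \<le> (\<Prod>i<b. real c)" by (intro prod_mono) auto
      then show ?thesis by simp
    qed (simp add: prod_diff_fact)
  qed
  have nh: "real n - real h = real (n - h)" using hn by simp
  have num: "(\<Prod>i<a. real h - real i) * (\<Prod>i<T - a. real n - real h - real i)
      \<le> real h ^ a * real (n - h) ^ (T - a)"
    unfolding nh by (intro mult_mono pow nonneg) auto
  have "real (n - h) = (1 - d) * real n" using nh assms(4) by (simp add: algebra_simps)
  then have e: "real h ^ a * real (n - h) ^ (T - a) = d ^ a * (1 - d) ^ (T - a) * real n ^ T"
    using assms(3,4) by (simp add: power_mult_distrib power_add[symmetric] mult_ac)
  have den: "(real n * ((real D - 1) / real D)) ^ T \<le> (\<Prod>i<T. real n - real i)"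
  proof -
    have "(\<Prod>i<T. real n * ((real D - 1) / real D)) \<le> (\<Prod>i<T. real n - real i)"
    proof (rule prod_mono, intro conjI)
      fix i assume "i \<in> {..<T}"
      then have "D * i \<le> n" using assms(2) by (meson dual_order.trans lessThan_iff less_imp_le_nat mult_le_mono2)
      then have "real D * real i \<le> real n" by (metis of_nat_le_iff of_nat_mult)
      then show "real n * ((real D - 1) / real D) \<le> real n - real i" "0 \<le> real n * ((real D - 1) / real D)"
        using assms(1) mult_right_mono[of 1 "real D" "real n"] by (simp_all add: field_simps)
    qed
    then show ?thesis by simp
  qed
  have pos: "0 < (real n * ((real D - 1) / real D)) ^ T" using assms by simp
  have "hyp_ratio n h T a \<le> d ^ a * (1 - d) ^ (T - a) * real n ^ T / (real n * ((real D - 1) / real D)) ^ T"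
    unfolding hyp_ratio_def using num e den pos assms by (intro frac_le) auto
  also have "\<dots> = (real D / (real D - 1)) ^ T * (d ^ a * (1 - d) ^ (T - a))"
    using assms by (simp add: power_mult_distrib power_divide)
  finally show ?thesis .
qed

lemma tendsto_prod_diff_div:
  "((\<lambda>n. (\<Prod>i<a. c * real n - real i) / real n ^ a) \<longlongrightarrow> c ^ a) sequentially"
proof -
  have "((\<lambda>n. \<Prod>i<a. (c * real n - real i) / real n) \<longlongrightarrow> (\<Prod>i<a. c)) sequentially"
  proof (intro tendsto_prod)
    fix i
    show "(\<lambda>n. (c * real n - real i) / real n) \<longlonglongrightarrow> c"
      by real_asymp
  qed
  then show ?thesis by (simp add: prod_dividef)
qed

lemma tendsto_hyp_ratio:
  assumes a: "a \<le> T" and h: "\<forall>\<^sub>F n in F. real (h n) = d * real n" and F: "F \<le> sequentially"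
  shows "((\<lambda>n. hyp_ratio n (h n) T a) \<longlongrightarrow> d ^ a * (1 - d) ^ (T - a)) F"
proof -
  \<comment> \<open>All three falling factorials are instances of one limit, with rates
    \<open>d\<close>, \<open>1 - d\<close> and \<open>1\<close>; the powers of \<open>n\<close>
    cancel because \<open>a + (T - a) = T\<close>.\<close>
  have "((\<lambda>n. ((\<Prod>i<a. d * real n - real i) / real n ^ a) *
      ((\<Prod>i<T - a. (1 - d) * real n - real i) / real n ^ (T - a)) /
      ((\<Prod>i<T. 1 * real n - real i) / real n ^ T)) \<longlongrightarrow> d ^ a * (1 - d) ^ (T - a) / 1 ^ T) F"
    by (intro tendsto_intros tendsto_mono[OF F tendsto_prod_diff_div]) auto
  moreover have "\<forall>\<^sub>F n in F. ((\<Prod>i<a. d * real n - real i) / real n ^ a) *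
      ((\<Prod>i<T - a. (1 - d) * real n - real i) / real n ^ (T - a)) /
      ((\<Prod>i<T. 1 * real n - real i) / real n ^ T) = hyp_ratio n (h n) T a"
    using h filter_leD[OF F eventually_gt_at_top[of 0]]
  proof eventually_elim
    case (elim n)
    have "real n ^ T = real n ^ a * real n ^ (T - a)"
      using a by (metis le_add_diff_inverse power_add)
    then show ?case using elim by (simp add: hyp_ratio_def algebra_simps)
  qed
  ultimately show ?thesis by (simp add: tendsto_cong)
qed

subsection \<open>Counting partial words\<close>

lemma bij_betw_PiE_Un:
  assumes "A \<inter> B = {}"
  shows "bij_betw (\<lambda>g. (restrict g A, restrict g B)) (Pi\<^sub>E (A \<union> B) S) (Pi\<^sub>E A S \<times> Pi\<^sub>E B S)"
  using assms
  by (intro bij_betw_byWitness[where f' = "\<lambda>(g, h) c. if c \<in> A then g c else h c"])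
    (auto simp: fun_eq_iff PiE_def Pi_def extensional_def split: if_splits)

text \<open>Independence of disjoint sets of positions: splitting a filling into its two
  restrictions is a bijection under which constraints and weights separate.\<close>

lemma sum_PiE_Un:
  fixes f :: "'i \<Rightarrow> 'b \<Rightarrow> 'c::comm_semiring_1"
  assumes "A \<inter> B = {}" "finite A" "finite B"
  shows "(\<Sum>g\<in>{g \<in> Pi\<^sub>E (A \<union> B) S. P (restrict g A) \<and> Q (restrict g B)}. \<Prod>c\<in>A \<union> B. f c (g c)) =
    (\<Sum>g\<in>{g \<in> Pi\<^sub>E A S. P g}. \<Prod>c\<in>A. f c (g c)) * (\<Sum>g\<in>{g \<in> Pi\<^sub>E B S. Q g}. \<Prod>c\<in>B. f c (g c))"
proof -
  let ?r = "\<lambda>g. (restrict g A, restrict g B)"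
  have "bij_betw ?r {g \<in> Pi\<^sub>E (A \<union> B) S. P (restrict g A) \<and> Q (restrict g B)}
      {x \<in> Pi\<^sub>E A S \<times> Pi\<^sub>E B S. P (fst x) \<and> Q (snd x)}"
    by (rule bij_betw_Collect[OF bij_betw_PiE_Un[OF assms(1)]]) simp
  moreover have "{x \<in> Pi\<^sub>E A S \<times> Pi\<^sub>E B S. P (fst x) \<and> Q (snd x)} =
      {g \<in> Pi\<^sub>E A S. P g} \<times> {g \<in> Pi\<^sub>E B S. Q g}" by auto
  ultimately have bij: "bij_betw ?r {g \<in> Pi\<^sub>E (A \<union> B) S. P (restrict g A) \<and> Q (restrict g B)}
      ({g \<in> Pi\<^sub>E A S. P g} \<times> {g \<in> Pi\<^sub>E B S. Q g})" by simp
  have "(\<Sum>g\<in>{g \<in> Pi\<^sub>E (A \<union> B) S. P (restrict g A) \<and> Q (restrict g B)}. \<Prod>c\<in>A \<union> B. f c (g c)) =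
    (\<Sum>(g, h)\<in>{g \<in> Pi\<^sub>E A S. P g} \<times> {g \<in> Pi\<^sub>E B S. Q g}. (\<Prod>c\<in>A. f c (g c)) * (\<Prod>c\<in>B. f c (h c)))"
    by (subst sum.reindex_bij_betw[OF bij, symmetric], intro sum.cong refl)
      (simp add: prod.union_disjoint assms)
  then show ?thesis
    by (simp add: sum_product sum.cartesian_product)
qed

section \<open>Weighted sums over fillings of positions\<close>

definition unifiable :: "('i \<Rightarrow> 'a option) \<Rightarrow> 'i set \<Rightarrow> bool" where
  "unifiable g C \<longleftrightarrow> (\<exists>a. \<forall>c\<in>C. g c = None \<or> g c = Some a)"

lemma unifiable_cong: "(\<And>c. c \<in> C \<Longrightarrow> g c = h c) \<Longrightarrow> unifiable g C \<longleftrightarrow> unifiable h C"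
  by (simp add: unifiable_def)

text \<open>The variable \<open>X\<close> marks holes, so multiplying over all positions of a word
  records its number of holes in the exponent.\<close>

definition weight :: "'a option \<Rightarrow> real poly" where
  "weight a = (if a = None then [:0, 1:] else 1)"

lemma sum_weight_UNIV:
  "(\<Sum>a\<in>(UNIV :: 'a::finite option set). weight a) = [:real CARD('a), 1:]"
proof -
  have "(\<Sum>a\<in>(UNIV :: 'a option set). weight a) = [:0, 1:] + (\<Sum>a\<in>(UNIV :: 'a set). 1)"
    by (simp add: UNIV_option_conv sum.reindex weight_def)
  then show ?thesis by (simp add: of_nat_poly)
qed

text \<open>The fillings are the all-hole filling \<open>z\<close> and, for each letter
  \<open>a\<close>, the set \<open>E a\<close> of fillings by \<open>a\<close> and holes in which
  \<open>a\<close> occurs. These sets are disjoint, since a filling common to two of them would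
  consist of holes only. Each contributes \<open>(1 + X) ^ k - X ^ k\<close>.\<close>

lemma sum_weight_unifiable:
  fixes C :: "'i set"
  assumes C: "finite C"
  shows "(\<Sum>g\<in>{g \<in> C \<rightarrow>\<^sub>E (UNIV :: 'a::finite option set). unifiable g C}. \<Prod>c\<in>C. weight (g c)) =
    class_poly CARD('a) (card C)"
proof -
  define z where "z = (\<lambda>c\<in>C. None :: 'a option)"
  define E where "E a = (C \<rightarrow>\<^sub>E {None, Some a}) - {z}" for a :: 'a
  have fin: "finite (C \<rightarrow>\<^sub>E {None, Some a})" for a :: 'a
    using C by (intro finite_PiE) auto
  have zmem: "z \<in> C \<rightarrow>\<^sub>E {None, Some a}" for a by (auto simp: z_def)
  have wz: "(\<Prod>c\<in>C. weight (z c)) = [:0, 1:] ^ card C"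
    by (simp add: z_def weight_def)
  have sumE: "(\<Sum>g\<in>E a. \<Prod>c\<in>C. weight (g c)) = [:1, 1:] ^ card C - [:0, 1:] ^ card C" for a
  proof -
    have "(\<Sum>g\<in>C \<rightarrow>\<^sub>E {None, Some a}. \<Prod>c\<in>C. weight (g c)) = (\<Prod>c\<in>C. \<Sum>b\<in>{None, Some a}. weight b)"
      using C by (intro prod_sum_PiE[symmetric]) auto
    also have "\<dots> = [:1, 1:] ^ card C" by (simp add: weight_def one_pCons)
    finally show ?thesis
      unfolding E_def using sum.remove[OF fin zmem, of "\<lambda>g. \<Prod>c\<in>C. weight (g c)" a] wz
      by simp
  qed
  have disj: "E a \<inter> E b = {}" if "a \<noteq> b" for a b
  proof (rule ccontr)
    assume "E a \<inter> E b \<noteq> {}"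
    then obtain g where g: "g \<in> E a" "g \<in> E b" by auto
    have "g c = z c" for c
    proof (cases "c \<in> C")
      case True
      with g have "g c \<in> {None, Some a}" "g c \<in> {None, Some b}"
        unfolding E_def by (meson DiffD1 PiE_mem)+
      with \<open>a \<noteq> b\<close> True show ?thesis by (auto simp: z_def)
    next
      case False
      have "g \<in> C \<rightarrow>\<^sub>E {None, Some a}" using g by (simp add: E_def)
      from PiE_arb[OF this False] False show ?thesis by (simp add: z_def)
    qed
    then have "g = z" by (simp add: fun_eq_iff)
    with g show False by (simp add: E_def)
  qed
  have eq: "{g \<in> C \<rightarrow>\<^sub>E (UNIV :: 'a option set). unifiable g C} = insert z (\<Union>a. E a)"
  proof (intro set_eqI iffI)
    fix g :: "'i \<Rightarrow> 'a option" assume g: "g \<in> {g \<in> C \<rightarrow>\<^sub>E UNIV. unifiable g C}"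
    then obtain a where "\<forall>c\<in>C. g c = None \<or> g c = Some a"
      by (auto simp: unifiable_def)
    with g have "g \<in> C \<rightarrow>\<^sub>E {None, Some a}"
      by (simp add: PiE_iff)
    then show "g \<in> insert z (\<Union>a. E a)"
      by (cases "g = z") (simp_all add: E_def, blast)
  next
    fix g assume "g \<in> insert z (\<Union>a. E a)"
    then obtain a where "g \<in> C \<rightarrow>\<^sub>E {None, Some a}"
      using zmem by (auto simp: E_def)
    then show "g \<in> {g \<in> C \<rightarrow>\<^sub>E UNIV. unifiable g C}"
      by (auto simp: PiE_iff unifiable_def)
  qed
  have finE: "finite (E a)" for a
    using fin by (simp add: E_def)
  have "(\<Sum>g\<in>{g \<in> C \<rightarrow>\<^sub>E (UNIV :: 'a option set). unifiable g C}. \<Prod>c\<in>C. weight (g c)) =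
      [:0, 1:] ^ card C + (\<Sum>g\<in>(\<Union>a. E a). \<Prod>c\<in>C. weight (g c))"
    unfolding eq wz[symmetric] by (rule sum.insert) (simp_all add: finE, simp add: E_def)
  also have "(\<Sum>g\<in>(\<Union>a. E a). \<Prod>c\<in>C. weight (g c)) =
      (\<Sum>a\<in>(UNIV :: 'a set). [:1, 1:] ^ card C - [:0, 1:] ^ card C)"
    by (subst sum.UNION_disjoint) (simp_all add: finE disj sumE)
  finally show ?thesis
    by (simp add: class_poly_def monom_altdef of_nat_poly algebra_simps smult_diff_left)
qed

lemma sum_weight_classes:
  fixes C :: "'k \<Rightarrow> 'i set"
  assumes "finite I" "\<And>\<kappa>. \<kappa> \<in> I \<Longrightarrow> finite (C \<kappa>)" "disjoint_family_on C I"
  shows "(\<Sum>g\<in>{g \<in> (\<Union>\<kappa>\<in>I. C \<kappa>) \<rightarrow>\<^sub>E (UNIV :: 'a::finite option set). \<forall>\<kappa>\<in>I. unifiable g (C \<kappa>)}.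
      \<Prod>c\<in>(\<Union>\<kappa>\<in>I. C \<kappa>). weight (g c)) = (\<Prod>\<kappa>\<in>I. class_poly CARD('a) (card (C \<kappa>)))"
  using assms
proof (induction I rule: finite_induct)
  case empty
  then show ?case by simp
next
  case (insert \<kappa> I)
  let ?U = "\<Union>\<kappa>\<in>I. C \<kappa>"
  have disj: "C \<kappa> \<inter> ?U = {}" and dis: "disjoint_family_on C I"
    using insert.prems(2) insert.hyps unfolding disjoint_family_on_def by auto
  have eq: "{g \<in> C \<kappa> \<union> ?U \<rightarrow>\<^sub>E (UNIV :: 'a option set). \<forall>\<kappa>\<in>insert \<kappa> I. unifiable g (C \<kappa>)} =
      {g \<in> C \<kappa> \<union> ?U \<rightarrow>\<^sub>E UNIV. unifiable (restrict g (C \<kappa>)) (C \<kappa>) \<and>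
        (\<forall>\<kappa>\<in>I. unifiable (restrict g ?U) (C \<kappa>))}"
  proof (intro Collect_cong conj_cong refl)
    fix g :: "'i \<Rightarrow> 'a option"
    have "unifiable (restrict g (C \<kappa>)) (C \<kappa>) \<longleftrightarrow> unifiable g (C \<kappa>)"
      by (rule unifiable_cong) auto
    moreover have "unifiable (restrict g ?U) (C \<iota>) \<longleftrightarrow> unifiable g (C \<iota>)" if "\<iota> \<in> I" for \<iota>
      by (rule unifiable_cong) (use that in auto)
    ultimately show "(\<forall>\<kappa>\<in>insert \<kappa> I. unifiable g (C \<kappa>)) \<longleftrightarrow> unifiable (restrict g (C \<kappa>)) (C \<kappa>) \<and>
        (\<forall>\<kappa>\<in>I. unifiable (restrict g ?U) (C \<kappa>))"
      by auto
  qed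
  have "(\<Sum>g\<in>{g \<in> C \<kappa> \<union> ?U \<rightarrow>\<^sub>E (UNIV :: 'a option set). \<forall>\<kappa>\<in>insert \<kappa> I. unifiable g (C \<kappa>)}.
      \<Prod>c\<in>C \<kappa> \<union> ?U. weight (g c)) =
    (\<Sum>g\<in>{g \<in> C \<kappa> \<rightarrow>\<^sub>E (UNIV :: 'a option set). unifiable g (C \<kappa>)}. \<Prod>c\<in>C \<kappa>. weight (g c)) *
    (\<Sum>g\<in>{g \<in> ?U \<rightarrow>\<^sub>E (UNIV :: 'a option set). \<forall>\<kappa>\<in>I. unifiable g (C \<kappa>)}. \<Prod>c\<in>?U. weight (g c))"
    unfolding eq by (rule sum_PiE_Un[OF disj, where f = "\<lambda>_. weight"]) (use insert in auto)
  then show ?case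
    using insert dis by (simp add: sum_weight_unifiable)
qed

lemma prod_weight_nth: "(\<Prod>i<length w. weight (w ! i)) = monom 1 (holes w)"
proof (induction w)
  case (Cons a w)
  then show ?case
    unfolding length_Cons prod.lessThan_Suc_shift
    by (simp add: weight_def holes_def monom_Suc)
qed (simp add: holes_def)

lemma finite_lists_length: "finite {w :: 'a::finite list. length w = n}"
  using finite_lists_length_eq[OF finite[of "UNIV :: 'a set"], of n] by simp

text \<open>Words become functions on their positions, and counting by holes becomes extracting a
  coefficient of a weighted sum. That sum factors over the classes and the free positions, each of
  the latter contributing \<open>X + m\<close>.\<close>

lemma card_words_unifiable:
  assumes "finite I" "disjoint_family_on C I" and sub: "\<And>\<kappa>. \<kappa> \<in> I \<Longrightarrow> C \<kappa> \<subseteq> {..<n}"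
  shows "real (card {w :: 'a::finite pword. length w = n \<and> holes w = h \<and> (\<forall>\<kappa>\<in>I. unifiable ((!) w) (C \<kappa>))}) =
    coeff ((\<Prod>\<kappa>\<in>I. class_poly CARD('a) (card (C \<kappa>))) *
      [:real CARD('a), 1:] ^ (n - (\<Sum>\<kappa>\<in>I. card (C \<kappa>)))) h"
proof -
  let ?U = "\<Union>\<kappa>\<in>I. C \<kappa>"
  let ?R = "{..<n} - ?U"
  let ?good = "\<lambda>g :: nat \<Rightarrow> 'a option. \<forall>\<kappa>\<in>I. unifiable g (C \<kappa>)"
  have fin: "finite (C \<kappa>)" if "\<kappa> \<in> I" for \<kappa>
    using sub[OF that] by (rule finite_subset) auto
  have U: "?U \<subseteq> {..<n}" using sub by blast
  have cardU: "card ?U = (\<Sum>\<kappa>\<in>I. card (C \<kappa>))"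
    using assms fin by (intro card_UN_disjoint) (auto simp: disjoint_family_on_def)
  have cardR: "card ?R = n - (\<Sum>\<kappa>\<in>I. card (C \<kappa>))"
    using U by (subst card_Diff_subset) (auto simp: cardU intro: finite_subset[OF U])
  have restr: "?good (restrict g ?U) \<longleftrightarrow> ?good g" for g
    by (intro ball_cong refl unifiable_cong) auto
  have "(\<Sum>w\<in>{w :: 'a pword. length w = n \<and> ?good ((!) w)}. monom 1 (holes w)) =
      (\<Sum>g\<in>{g \<in> {..<n} \<rightarrow>\<^sub>E UNIV. ?good g}. \<Prod>c<n. weight (g c))"
  proof (rule sum.reindex_bij_witness[where i = "\<lambda>g. map g [0..<n]" and j = "\<lambda>w. \<lambda>i\<in>{..<n}. w ! i"])
    fix w :: "'a pword" assume w: "w \<in> {w. length w = n \<and> ?good ((!) w)}"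
    then show "map (\<lambda>i\<in>{..<n}. w ! i) [0..<n] = w" by (auto intro!: nth_equalityI)
    have "unifiable (\<lambda>i\<in>{..<n}. w ! i) (C \<kappa>) \<longleftrightarrow> unifiable ((!) w) (C \<kappa>)" if "\<kappa> \<in> I" for \<kappa>
      using sub[OF that] by (intro unifiable_cong) auto
    with w show "(\<lambda>i\<in>{..<n}. w ! i) \<in> {g \<in> {..<n} \<rightarrow>\<^sub>E UNIV. ?good g}" by auto
    show "(\<Prod>c<n. weight ((\<lambda>i\<in>{..<n}. w ! i) c)) = monom 1 (holes w)"
      using w by (simp flip: prod_weight_nth)
  next
    fix g :: "nat \<Rightarrow> 'a option" assume g: "g \<in> {g \<in> {..<n} \<rightarrow>\<^sub>E UNIV. ?good g}"
    then show "(\<lambda>i\<in>{..<n}. map g [0..<n] ! i) = g"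
      by (auto simp: fun_eq_iff PiE_def extensional_def)
    have "unifiable ((!) (map g [0..<n])) (C \<kappa>) \<longleftrightarrow> unifiable g (C \<kappa>)" if "\<kappa> \<in> I" for \<kappa>
      using sub[OF that] by (intro unifiable_cong) auto
    with g show "map g [0..<n] \<in> {w. length w = n \<and> ?good ((!) w)}" by auto
  qed
  \<comment> \<open>The conjunct \<open>True\<close> is the empty constraint on the free positions,
    which gives the condition the shape expected by \<open>sum_PiE_Un\<close>.\<close>
  also have "\<dots> = (\<Sum>g\<in>{g \<in> ?U \<union> ?R \<rightarrow>\<^sub>E UNIV. ?good (restrict g ?U) \<and> True}. \<Prod>c\<in>?U \<union> ?R. weight (g c))"
  proof -
    have "?U \<union> ?R = {..<n}" using U by blast
    then show ?thesis unfolding restr by simp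
  qed
  also have "\<dots> = (\<Sum>g\<in>{g \<in> ?U \<rightarrow>\<^sub>E UNIV. ?good g}. \<Prod>c\<in>?U. weight (g c)) *
      (\<Sum>g\<in>{g \<in> ?R \<rightarrow>\<^sub>E (UNIV :: 'a option set). True}. \<Prod>c\<in>?R. weight (g c))"
    by (rule sum_PiE_Un[where f = "\<lambda>_. weight" and P = ?good and Q = "\<lambda>_. True"])
      (auto intro: finite_subset[OF U])
  also have "(\<Sum>g\<in>{g \<in> ?R \<rightarrow>\<^sub>E (UNIV :: 'a option set). True}. \<Prod>c\<in>?R. weight (g c)) =
      [:real CARD('a), 1:] ^ (n - (\<Sum>\<kappa>\<in>I. card (C \<kappa>)))"
    using prod_sum_PiE[of ?R "\<lambda>_. UNIV :: 'a option set" "\<lambda>_. weight"]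
    by (simp add: sum_weight_UNIV cardR del: Collect_mem_eq)
  also have "(\<Sum>g\<in>{g \<in> ?U \<rightarrow>\<^sub>E UNIV. ?good g}. \<Prod>c\<in>?U. weight (g c)) =
      (\<Prod>\<kappa>\<in>I. class_poly CARD('a) (card (C \<kappa>)))"
    using assms fin by (intro sum_weight_classes)
  finally have "coeff (\<Sum>w\<in>{w :: 'a pword. length w = n \<and> ?good ((!) w)}. monom 1 (holes w)) h =
    coeff ((\<Prod>\<kappa>\<in>I. class_poly CARD('a) (card (C \<kappa>))) *
      [:real CARD('a), 1:] ^ (n - (\<Sum>\<kappa>\<in>I. card (C \<kappa>)))) h" by simp
  moreover have "coeff (\<Sum>w\<in>{w :: 'a pword. length w = n \<and> ?good ((!) w)}. monom 1 (holes w) :: real poly) h =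
      real (card {w :: 'a pword. length w = n \<and> holes w = h \<and> ?good ((!) w)})"
  proof -
    have "finite {w :: 'a pword. length w = n \<and> ?good ((!) w)}"
      by (rule finite_subset[OF _ finite_lists_length[of n]]) auto
    then have "coeff (\<Sum>w\<in>{w :: 'a pword. length w = n \<and> ?good ((!) w)}. monom 1 (holes w) :: real poly) h =
      real (card ({w :: 'a pword. length w = n \<and> ?good ((!) w)} \<inter> {w. holes w = h}))"
      by (simp add: coeff_sum sum.If_cases)
    also have "{w :: 'a pword. length w = n \<and> ?good ((!) w)} \<inter> {w. holes w = h} =
      {w. length w = n \<and> holes w = h \<and> ?good ((!) w)}" by auto
    finally show ?thesis .
  qed
  ultimately show ?thesis by simp
qed

subsection \<open>Divided factors\<close>

definition block_start :: "'v list \<Rightarrow> ('v \<Rightarrow> nat) \<Rightarrow> nat \<Rightarrow> nat" where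
  "block_start p L j = (\<Sum>l<j. L (p ! l))"

definition total_length :: "'v list \<Rightarrow> ('v \<Rightarrow> nat) \<Rightarrow> nat" where
  "total_length p L = (\<Sum>v\<in>set p. count_list p v * L v)"

definition position_class :: "'v list \<Rightarrow> nat \<Rightarrow> ('v \<Rightarrow> nat) \<Rightarrow> 'v \<times> nat \<Rightarrow> nat set" where
  "position_class p i L = (\<lambda>(v, t). (\<lambda>j. i + block_start p L j + t) ` {j. j < length p \<and> p ! j = v})"

definition fits :: "'v list \<Rightarrow> 'a pword \<Rightarrow> nat \<Rightarrow> ('v \<Rightarrow> nat) \<Rightarrow> bool" where
  "fits p w i L \<longleftrightarrow> (\<forall>\<kappa>\<in>(SIGMA v : set p. {..<L v}). unifiable ((!) w) (position_class p i L \<kappa>))"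

text \<open>Lengths are kept per variable rather than per letter of \<open>p\<close> as in
  \<open>occurrences\<close>. Extensionality makes \<open>L\<close> recoverable from
  \<open>map L p\<close>, so both encodings have the same cardinality.\<close>

definition divisions :: "'v list \<Rightarrow> nat \<Rightarrow> (nat \<times> ('v \<Rightarrow> nat)) set" where
  "divisions p n = {(i, L). L \<in> set p \<rightarrow>\<^sub>E {1..} \<and> i + total_length p L \<le> n}"

section \<open>Block and offset as coordinates of a position\<close>

lemma block_start_length: "block_start p L (length p) = total_length p L"
  using sum_list_map_eq_sum_count[of L p]
  by (simp add: block_start_def total_length_def sum_list_sum_nth lessThan_atLeast0)

lemma length_morph: "length (morph h p) = total_length p (\<lambda>v. length (h v))"
  using sum_list_map_eq_sum_count[of "\<lambda>v. length (h v)" p]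
  by (simp add: morph_def total_length_def length_concat o_def)

lemma block_start_Suc: "block_start (v # p) L (Suc j) = L v + block_start p L j"
  unfolding block_start_def sum.lessThan_Suc_shift by simp

lemma block_start_0 [simp]: "block_start p L 0 = 0"
  by (simp add: block_start_def)

lemma block_start_less:
  assumes "j < j'" "t < L (p ! j)"
  shows "block_start p L j + t < block_start p L j'"
proof -
  have "block_start p L (Suc j) \<le> block_start p L j'"
    unfolding block_start_def using assms by (intro sum_mono2) auto
  then show ?thesis using assms by (simp add: block_start_def)
qed

lemma block_index_unique:
  assumes "block_start p L j + t = block_start p L j' + t'" "t < L (p ! j)" "t' < L (p ! j')"
  shows "j = j' \<and> t = t'"
  using assms block_start_less[of j j' t L p] block_start_less[of j' j t' L p]
  by (cases j j' rule: linorder_cases) auto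

text \<open>Together with \<open>block_index_unique\<close>, this lets every position of the factor
  be addressed by its block and its offset in that block.\<close>

lemma block_index_exists:
  assumes "q < block_start p L (length p)"
  shows "\<exists>j t. j < length p \<and> t < L (p ! j) \<and> q = block_start p L j + t"
  using assms
proof (induction p arbitrary: q)
  case (Cons v p)
  show ?case
  proof (cases "q < L v")
    case True
    then show ?thesis by (intro exI[of _ 0] exI[of _ q]) auto
  next
    case False
    then have "q - L v < block_start p L (length p)"
      using Cons.prems by (simp add: block_start_Suc)
    from Cons.IH[OF this] obtain j t where
      "j < length p" "t < L (p ! j)" "q - L v = block_start p L j + t" by blast
    with False show ?thesis
      by (intro exI[of _ "Suc j"] exI[of _ t]) (auto simp: block_start_Suc)
  qed
qed simp

lemma nth_morph:
  assumes "j < length p" "t < length (h (p ! j))"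
  shows "morph h p ! (block_start p (\<lambda>v. length (h v)) j + t) = h (p ! j) ! t"
  using assms
proof (induction p arbitrary: j)
  case (Cons v p)
  then show ?case
    by (cases j) (auto simp: morph_def block_start_Suc nth_append)
qed simp

lemma compatible_morph_iff:
  assumes "i + length (morph h p) \<le> length w"
  shows "factor_at w i (length (morph h p)) \<up> map Some (morph h p) \<longleftrightarrow>
    (\<forall>j<length p. \<forall>t<length (h (p ! j)).
      w ! (i + block_start p (\<lambda>v. length (h v)) j + t) \<in> {None, Some (h (p ! j) ! t)})"
    (is "?l \<longleftrightarrow> ?r")
proof -
  let ?L = "\<lambda>v. length (h v)"
  have len: "length (morph h p) = block_start p ?L (length p)"
    by (simp add: length_morph block_start_length)
  have "?l \<longleftrightarrow> (\<forall>q<length (morph h p). w ! (i + q) \<in> {None, Some (morph h p ! q)})"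
    using assms by (auto simp: compatible_def factor_at_def)
  also have "\<dots> \<longleftrightarrow> ?r"
  proof (intro iffI allI impI)
    fix j t assume *: "\<forall>q<length (morph h p). w ! (i + q) \<in> {None, Some (morph h p ! q)}"
      "j < length p" "t < ?L (p ! j)"
    then have "block_start p ?L j + t < length (morph h p)"
      unfolding len by (intro block_start_less)
    with * show "w ! (i + block_start p ?L j + t) \<in> {None, Some (h (p ! j) ! t)}"
      using nth_morph[of j p t h] by (metis add.assoc)
  next
    fix q assume *: ?r "q < length (morph h p)"
    with block_index_exists[of q p ?L] obtain j t where
      "j < length p" "t < ?L (p ! j)" "q = block_start p ?L j + t"
      unfolding len by blast
    with * show "w ! (i + q) \<in> {None, Some (morph h p ! q)}"
      using nth_morph[of j p t h] by (metis add.assoc)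
  qed
  finally show ?thesis .
qed

text \<open>The function \<open>c\<close> collects one witness letter per class, so
  \<open>c v\<close> spells a possible image of \<open>v\<close>. This is the bridge from classes to
  morphisms.\<close>

lemma fits_iff:
  "fits p w i L \<longleftrightarrow> (\<exists>c. \<forall>j<length p. \<forall>t<L (p ! j).
    w ! (i + block_start p L j + t) \<in> {None, Some (c (p ! j) t)})" (is "_ \<longleftrightarrow> ?r")
proof
  assume *: "fits p w i L"
  define c where "c v t = (SOME a. \<forall>x\<in>position_class p i L (v, t). w ! x = None \<or> w ! x = Some a)" for v t
  have c: "w ! x = None \<or> w ! x = Some (c v t)"
    if "v \<in> set p" "t < L v" "x \<in> position_class p i L (v, t)" for v t x
  proof -
    have "\<exists>a. \<forall>x\<in>position_class p i L (v, t). w ! x = None \<or> w ! x = Some a"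
      using * that by (auto simp: fits_def unifiable_def)
    from someI_ex[OF this] that(3) show ?thesis unfolding c_def by blast
  qed
  show ?r
  proof (intro exI[of _ c] allI impI)
    fix j t assume "j < length p" "t < L (p ! j)"
    then show "w ! (i + block_start p L j + t) \<in> {None, Some (c (p ! j) t)}"
      using c[of "p ! j" t "i + block_start p L j + t"] by (auto simp: position_class_def)
  qed
next
  assume ?r
  then obtain c where c: "w ! (i + block_start p L j + t) \<in> {None, Some (c (p ! j) t)}"
    if "j < length p" "t < L (p ! j)" for j t by blast
  have "\<exists>a. \<forall>x\<in>position_class p i L (v, t). w ! x = None \<or> w ! x = Some a" if "t < L v" for v t
    by (rule exI[of _ "c v t"]) (use c that in \<open>auto simp: position_class_def\<close>)
  then show "fits p w i L"
    by (auto simp: fits_def unifiable_def)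
qed

text \<open>An occurrence records only the lengths of the images, so all that matters is whether
  some morphism with these lengths matches. A matching morphism supplies the letters of the classes,
  and conversely letters chosen for the classes spell a morphism, nonerasing because all lengths are
  positive.\<close>

lemma occurrences_eq_image:
  "occurrences p w = (\<lambda>(i, L). (i, map L p)) ` {(i, L) \<in> divisions p (length w). fits p w i L}"
proof (intro set_eqI iffI)
  fix x assume "x \<in> occurrences p w"
  then obtain i h where h: "h \<in> nonerasing_morphisms p" "i + length (morph h p) \<le> length w"
      "factor_at w i (length (morph h p)) \<up> map Some (morph h p)"
    and x: "x = (i, map (\<lambda>v. length (h v)) p)"
    by (auto simp: occurrences_def encounters_def)
  define L where "L = restrict (\<lambda>v. length (h v)) (set p)"
  have start: "block_start p L j = block_start p (\<lambda>v. length (h v)) j" if "j \<le> length p" for j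
    unfolding block_start_def by (rule sum.cong) (use that in \<open>auto simp: L_def\<close>)
  have "total_length p L = total_length p (\<lambda>v. length (h v))"
    by (simp add: total_length_def L_def)
  then have "(i, L) \<in> divisions p (length w)"
    using h by (auto simp: divisions_def length_morph L_def nonerasing_morphisms_def PiE_iff Suc_le_eq)
  moreover have "fits p w i L"
    unfolding fits_iff
  proof (intro exI[of _ "\<lambda>v t. h v ! t"] allI impI)
    fix j t assume "j < length p" "t < L (p ! j)"
    then show "w ! (i + block_start p L j + t) \<in> {None, Some (h (p ! j) ! t)}"
      using h(3) compatible_morph_iff[OF h(2)] start[of j] by (simp add: L_def)
  qed
  moreover have "x = (i, map L p)" by (simp add: x L_def)
  ultimately show "x \<in> (\<lambda>(i, L). (i, map L p)) ` {(i, L) \<in> divisions p (length w). fits p w i L}"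
    by (intro image_eqI[of _ _ "(i, L)"]) auto
next
  fix x assume "x \<in> (\<lambda>(i, L). (i, map L p)) ` {(i, L) \<in> divisions p (length w). fits p w i L}"
  then obtain i L where L: "(i, L) \<in> divisions p (length w)" "fits p w i L" and x: "x = (i, map L p)"
    by auto
  from L(2) obtain c where c: "w ! (i + block_start p L j + t) \<in> {None, Some (c (p ! j) t)}"
    if "j < length p" "t < L (p ! j)" for j t unfolding fits_iff by blast
  define h where "h = (\<lambda>v\<in>set p. map (c v) [0..<L v])"
  have start: "block_start p (\<lambda>v. length (h v)) j = block_start p L j" if "j \<le> length p" for j
    unfolding block_start_def by (rule sum.cong) (use that in \<open>auto simp: h_def\<close>)
  have "total_length p (\<lambda>v. length (h v)) = total_length p L"
    by (simp add: total_length_def h_def)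
  then have le: "i + length (morph h p) \<le> length w"
    using L by (simp add: divisions_def length_morph)
  have "L v \<noteq> 0" if "v \<in> set p" for v
    using L(1) that by (auto simp: divisions_def PiE_iff)
  then have "h \<in> nonerasing_morphisms p"
    by (auto simp: nonerasing_morphisms_def h_def)
  moreover have "factor_at w i (length (morph h p)) \<up> map Some (morph h p)"
    unfolding compatible_morph_iff[OF le]
  proof (intro allI impI)
    fix j t assume jt: "j < length p" "t < length (h (p ! j))"
    then show "w ! (i + block_start p (\<lambda>v. length (h v)) j + t) \<in> {None, Some (h (p ! j) ! t)}"
      using c[of j t] start[of j] by (simp add: h_def)
  qed
  ultimately have "(i, h) \<in> encounters p w"
    using le by (simp add: encounters_def)
  moreover have "x = (i, map (\<lambda>v. length (h v)) p)"
    by (simp add: x h_def)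
  ultimately show "x \<in> occurrences p w"
    unfolding occurrences_def by (intro image_eqI[of _ _ "(i, h)"]) auto
qed

lemma card_occurrences:
  "card (occurrences p w) = card {(i, L) \<in> divisions p (length w). fits p w i L}"
proof -
  have "inj_on (\<lambda>(i, L). (i, map L p)) {(i, L) \<in> divisions p (length w). fits p w i L}"
    by (auto simp: inj_on_def divisions_def intro: PiE_ext)
  then show ?thesis unfolding occurrences_eq_image by (rule card_image)
qed

lemma finite_divisions: "finite (divisions p n)"
proof -
  have le: "L v \<le> n" if "i + total_length p L \<le> n" "v \<in> set p" for i L v
  proof -
    have "1 * L v \<le> count_list p v * L v"
      using that by (intro mult_right_mono) (auto simp: Suc_le_eq count_list_0_iff gr0_conv_Suc[symmetric] intro!: gr0I)
    also have "\<dots> \<le> total_length p L"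
      unfolding total_length_def using that by (intro member_le_sum) auto
    finally show ?thesis using that by simp
  qed
  have "divisions p n \<subseteq> {..n} \<times> (set p \<rightarrow>\<^sub>E {..n})"
  proof (rule subsetI)
    fix x assume "x \<in> divisions p n"
    then show "x \<in> {..n} \<times> (set p \<rightarrow>\<^sub>E {..n})"
      using le[of "fst x" "snd x"] by (cases x) (simp add: divisions_def PiE_iff)
  qed
  then show ?thesis by (rule finite_subset) (auto intro!: finite_PiE)
qed

lemma inj_block_start:
  assumes "\<And>v. v \<in> set p \<Longrightarrow> 0 < L v"
  shows "inj_on (block_start p L) {..<length p}"
proof (rule inj_onI)
  fix j j' assume "j \<in> {..<length p}" "j' \<in> {..<length p}" "block_start p L j = block_start p L j'"
  then show "j = j'" using block_index_unique[of p L j 0 j' 0] assms by simp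
qed

text \<open>Blocks are nonempty, so different blocks of a variable start at different positions and
  contribute different elements.\<close>

lemma card_position_class:
  assumes "\<And>v. v \<in> set p \<Longrightarrow> 0 < L v"
  shows "card (position_class p i L (v, t)) = count_list p v"
proof -
  have "inj_on (\<lambda>j. i + block_start p L j + t) {j. j < length p \<and> p ! j = v}"
    using inj_on_subset[OF inj_block_start[of p L, OF assms], of "{j. j < length p \<and> p ! j = v}"]
    by (auto simp: inj_on_def)
  then have "card (position_class p i L (v, t)) = card {j. j < length p \<and> p ! j = v}"
    by (simp add: position_class_def card_image)
  also have "\<dots> = count_list p v"
    by (simp add: count_list_eq_length_filter length_filter_conv_card eq_commute)
  finally show ?thesis .
qed

text \<open>Different pairs of a variable and an offset give disjoint classes, and \<open>v\<close>
  owns \<open>L v\<close> classes of equal size. Neither the position \<open>i\<close> nor the order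
  of the variables in \<open>p\<close> survives on the right.\<close>

lemma card_words_fits:
  assumes "(i, L) \<in> divisions p n"
  shows "real (card {w :: 'a::finite pword. length w = n \<and> holes w = h \<and> fits p w i L}) =
    coeff ((\<Prod>v\<in>set p. class_poly CARD('a) (count_list p v) ^ L v) *
      [:real CARD('a), 1:] ^ (n - total_length p L)) h"
proof -
  let ?I = "SIGMA v : set p. {..<L v}"
  have L: "0 < L v" if "v \<in> set p" for v
    using assms that by (auto simp: divisions_def PiE_iff Suc_le_eq)
  have disj: "disjoint_family_on (position_class p i L) ?I"
    unfolding disjoint_family_on_def
  proof (intro ballI impI, rule ccontr)
    fix \<kappa> \<kappa>' assume \<kappa>: "\<kappa> \<in> ?I" "\<kappa>' \<in> ?I" "\<kappa> \<noteq> \<kappa>'"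
      "position_class p i L \<kappa> \<inter> position_class p i L \<kappa>' \<noteq> {}"
    obtain v t v' t' where eq: "\<kappa> = (v, t)" "\<kappa>' = (v', t')" by (cases \<kappa>, cases \<kappa>')
    from \<kappa> have *: "t < L v" "t' < L v'" "\<not> (v = v' \<and> t = t')"
      "position_class p i L (v, t) \<inter> position_class p i L (v', t') \<noteq> {}"
      unfolding eq by auto
    then obtain x where "x \<in> position_class p i L (v, t)" "x \<in> position_class p i L (v', t')"
      by blast
    then obtain j j' where j: "j < length p" "p ! j = v" "j' < length p" "p ! j' = v'"
      "block_start p L j + t = block_start p L j' + t'"
      unfolding position_class_def by auto
    with * block_index_unique[of p L j t j' t'] show False by auto
  qed
  have sub: "position_class p i L \<kappa> \<subseteq> {..<n}" if \<kappa>: "\<kappa> \<in> ?I" for \<kappa>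
  proof -
    have "i + block_start p L (length p) \<le> n"
      using assms by (simp add: divisions_def block_start_length)
    then have "i + block_start p L j + t < n" if "j < length p" "t < L (p ! j)" for j t
      using block_start_less[of j "length p" t L p] that by linarith
    with \<kappa> show ?thesis by (auto simp: position_class_def)
  qed
  have "(\<Sum>\<kappa>\<in>?I. card (position_class p i L \<kappa>)) = (\<Sum>(v, t)\<in>?I. count_list p v)"
    using L by (intro sum.cong) (auto simp: card_position_class)
  also have "\<dots> = (\<Sum>v\<in>set p. \<Sum>t<L v. count_list p v)"
    by (rule sum.Sigma[symmetric]) auto
  finally have cards: "(\<Sum>\<kappa>\<in>?I. card (position_class p i L \<kappa>)) = total_length p L"
    by (simp add: total_length_def mult.commute)
  have "(\<Prod>\<kappa>\<in>?I. class_poly CARD('a) (card (position_class p i L \<kappa>))) =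
      (\<Prod>(v, t)\<in>?I. class_poly CARD('a) (count_list p v))"
    using L by (intro prod.cong) (auto simp: card_position_class)
  also have "\<dots> = (\<Prod>v\<in>set p. \<Prod>t<L v. class_poly CARD('a) (count_list p v))"
    by (rule prod.Sigma[symmetric]) auto
  finally have prods: "(\<Prod>\<kappa>\<in>?I. class_poly CARD('a) (card (position_class p i L \<kappa>))) =
      (\<Prod>v\<in>set p. class_poly CARD('a) (count_list p v) ^ L v)"
    by simp
  show ?thesis
    using card_words_unifiable[OF _ disj sub, where 'a = 'a and h = h]
    by (simp add: fits_def cards prods)
qed

text \<open>Double counting of the pairs of a word and a division that fits it.\<close>

lemma sum_card_occurrences:
  "(\<Sum>w\<in>{w :: 'a::finite pword. length w = n \<and> holes w = h}. real (card (occurrences p w))) =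
    (\<Sum>(i, L)\<in>divisions p n. coeff ((\<Prod>v\<in>set p. class_poly CARD('a) (count_list p v) ^ L v) *
      [:real CARD('a), 1:] ^ (n - total_length p L)) h)"
proof -
  let ?W = "{w :: 'a pword. length w = n \<and> holes w = h}"
  have fin: "finite ?W"
    by (rule finite_subset[OF _ finite_lists_length[of n]]) auto
  have "real (card (occurrences p w)) = (\<Sum>(i, L)\<in>divisions p n. if fits p w i L then 1 else 0)"
    if "w \<in> ?W" for w
  proof -
    have "(\<Sum>(i, L)\<in>divisions p n. if fits p w i L then 1 else (0::real)) =
        real (card (divisions p n \<inter> {(i, L). fits p w i L}))"
      using finite_divisions[of p n] by (simp add: sum.If_cases case_prod_unfold)
    also have "divisions p n \<inter> {(i, L). fits p w i L} = {(i, L) \<in> divisions p n. fits p w i L}" by auto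
    finally show ?thesis using that by (simp add: card_occurrences)
  qed
  then have "(\<Sum>w\<in>?W. real (card (occurrences p w))) =
      (\<Sum>w\<in>?W. \<Sum>(i, L)\<in>divisions p n. if fits p w i L then 1 else 0)"
    by (intro sum.cong) auto
  also have "\<dots> = (\<Sum>(i, L)\<in>divisions p n. \<Sum>w\<in>?W. if fits p w i L then 1 else 0)"
    unfolding case_prod_unfold by (rule sum.swap)
  also have "\<dots> = (\<Sum>(i, L)\<in>divisions p n. real (card {w :: 'a pword. length w = n \<and> holes w = h \<and> fits p w i L}))"
  proof (intro sum.cong refl, clarify)
    fix i L
    have "?W \<inter> {w. fits p w i L} = {w. length w = n \<and> holes w = h \<and> fits p w i L}" by auto
    then show "(\<Sum>w\<in>?W. if fits p w i L then 1 else 0) =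
        real (card {w :: 'a pword. length w = n \<and> holes w = h \<and> fits p w i L})"
      using fin by (simp add: sum.If_cases)
  qed
  also have "\<dots> = (\<Sum>(i, L)\<in>divisions p n. coeff ((\<Prod>v\<in>set p. class_poly CARD('a) (count_list p v) ^ L v) *
      [:real CARD('a), 1:] ^ (n - total_length p L)) h)"
    by (intro sum.cong refl) (auto simp: card_words_fits)
  finally show ?thesis .
qed

subsection \<open>Summing out the variables that occur once\<close>

text \<open>List \<open>V\<close> in some order: the partial sums starting from \<open>i\<close>
  form a strictly increasing sequence in \<open>{0..N}\<close>, hence a choice of
  \<open>card V + 1\<close> out of \<open>N + 1\<close> numbers. The induction removes one variable
  and sums over its length; finiteness is carried along for the disjoint union.\<close>

lemma card_bounded_sums:
  assumes "finite V"
  shows "finite {(i, S). S \<in> V \<rightarrow>\<^sub>E {1..} \<and> i + (\<Sum>v\<in>V. S v) \<le> N} \<and>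
    card {(i, S). S \<in> V \<rightarrow>\<^sub>E {1..} \<and> i + (\<Sum>v\<in>V. S v) \<le> N} = Suc N choose Suc (card V)"
  using assms
proof (induction V arbitrary: N rule: finite_induct)
  case empty
  have eq: "{(i, S). S \<in> {} \<rightarrow>\<^sub>E {1..} \<and> i + (\<Sum>v\<in>{}. S v) \<le> N} =
      (\<lambda>i. (i, \<lambda>_. undefined)) ` {..N :: nat}" by auto
  show ?case unfolding eq by (subst card_image) (auto simp: inj_on_def)
next
  case (insert v V)
  define Z where "Z N = {(i :: nat, S). S \<in> V \<rightarrow>\<^sub>E {1..} \<and> i + (\<Sum>v\<in>V. S v) \<le> N}" for N :: nat
  define e where "e l = (\<lambda>(i :: nat, S :: 'a \<Rightarrow> nat). (i, S(v := l)))" for l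
  have IH: "finite (Z N)" "card (Z N) = Suc N choose Suc (card V)" for N
    using insert.IH unfolding Z_def by auto
  have sum_upd: "(\<Sum>u\<in>V. if u = v then l else S u) = (\<Sum>u\<in>V. S u)" for l :: nat and S
    using insert.hyps by (intro sum.cong) auto
  have eq: "{(i, S). S \<in> insert v V \<rightarrow>\<^sub>E {1..} \<and> i + (\<Sum>v\<in>insert v V. S v) \<le> N} =
      (\<Union>l\<in>{1..N}. e l ` Z (N - l))" (is "?X = ?Y")
  proof (intro set_eqI iffI)
    fix x assume x: "x \<in> ?X"
    obtain i S where [simp]: "x = (i, S)" by (cases x)
    have S: "S \<in> insert v V \<rightarrow>\<^sub>E {1..}" "i + S v + (\<Sum>u\<in>V. S u) \<le> N"
      using x insert.hyps by auto
    then have "1 \<le> S v" by (auto simp: PiE_iff)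
    moreover have "(i, S(v := undefined)) \<in> Z (N - S v)"
      using S insert.hyps by (auto simp: Z_def PiE_iff extensional_def sum_upd)
    moreover have "x = e (S v) (i, S(v := undefined))" by (simp add: e_def)
    ultimately show "x \<in> ?Y" using S by (intro UN_I[of "S v"]) auto
  next
    fix x assume "x \<in> ?Y"
    then obtain l i S where "1 \<le> l" "l \<le> N" "(i, S) \<in> Z (N - l)" "x = (i, S(v := l))"
      by (auto simp: e_def)
    then show "x \<in> ?X"
      using insert.hyps by (auto simp: Z_def PiE_iff extensional_def sum_upd)
  qed
  have inj: "inj_on (e l) (Z N)" for l N
  proof (rule inj_onI)
    fix x y assume *: "x \<in> Z N" "y \<in> Z N" "e l x = e l y"
    obtain i S i' S' where [simp]: "x = (i, S)" "y = (i', S')" by (cases x, cases y)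
    have "S u = S' u" for u
    proof (cases "u = v")
      case True
      then show ?thesis using * insert.hyps by (auto simp: Z_def PiE_iff extensional_def)
    next
      case False
      then show ?thesis using * by (auto simp: e_def dest: fun_cong[of _ _ u])
    qed
    then show "x = y" using * by (auto simp: e_def)
  qed
  have disj: "e l ` A \<inter> e l' ` B = {}" if "l \<noteq> l'" for l l' A B
    using that by (auto simp: e_def dest: fun_cong[of _ _ v])
  have "card ?Y = (\<Sum>l\<in>{1..N}. card (e l ` Z (N - l)))"
    using IH disj by (intro card_UN_disjoint) auto
  also have "\<dots> = (\<Sum>l\<in>{1..N}. Suc (N - l) choose Suc (card V))"
    by (simp add: card_image[OF inj] IH)
  \<comment> \<open>Substituting \<open>j = N + 1 - l\<close> prepares the hockey-stick identity.
    The missing term \<open>j = 0\<close> is zero because the lower index is positive.\<close>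
  also have "\<dots> = (\<Sum>j\<in>{1..N}. j choose Suc (card V))"
    by (rule sum.reindex_bij_witness[where i = "\<lambda>j. Suc N - j" and j = "\<lambda>l. Suc N - l"])
      (auto simp: Suc_diff_le)
  also have "\<dots> = (\<Sum>j\<in>{0..N}. j choose Suc (card V))"
    by (intro sum.mono_neutral_left) (auto simp: not_le)
  also have "\<dots> = Suc N choose Suc (card (insert v V))"
    using insert.hyps sum_choose_upper[of "Suc (card V)" N] by (simp add: atLeast0AtMost del: binomial_Suc_Suc)
  finally show ?case
    unfolding eq using IH by simp
qed

section \<open>Grouping divisions by the lengths of the repeated variables\<close>

definition repeated_vars :: "'v list \<Rightarrow> 'v set" where
  "repeated_vars p = {v \<in> set p. 1 < count_list p v}"

definition repeated_length :: "'v list \<Rightarrow> ('v \<Rightarrow> nat) \<Rightarrow> nat" where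
  "repeated_length p M = (\<Sum>v\<in>repeated_vars p. count_list p v * M v)"

definition repeated_divisions :: "'v list \<Rightarrow> nat \<Rightarrow> ('v \<Rightarrow> nat) set" where
  "repeated_divisions p n = {M \<in> repeated_vars p \<rightarrow>\<^sub>E {1..}. repeated_length p M \<le> n}"

definition fit_poly :: "nat \<Rightarrow> 'v list \<Rightarrow> ('v \<Rightarrow> nat) \<Rightarrow> real poly" where
  "fit_poly m p M = (\<Prod>v\<in>repeated_vars p. class_poly m (count_list p v) ^ M v)"

lemma finite_repeated_vars [simp]: "finite (repeated_vars p)"
  by (simp add: repeated_vars_def)

lemma count_list_single: "v \<in> set p - repeated_vars p \<Longrightarrow> count_list p v = 1"
  using count_list_0_iff[of p v] by (auto simp: repeated_vars_def)

lemma total_length_split: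
  "total_length p L = repeated_length p L + (\<Sum>v\<in>set p - repeated_vars p. L v)"
proof -
  have "total_length p L = repeated_length p L + (\<Sum>v\<in>set p - repeated_vars p. count_list p v * L v)"
    unfolding total_length_def repeated_length_def
    by (subst sum.subset_diff[of "repeated_vars p"]) (auto simp: repeated_vars_def)
  also have "(\<Sum>v\<in>set p - repeated_vars p. count_list p v * L v) = (\<Sum>v\<in>set p - repeated_vars p. L v)"
    by (intro sum.cong) (auto simp: count_list_single)
  finally show ?thesis .
qed

lemma prod_class_poly_split:
  assumes "total_length p L \<le> n"
  shows "(\<Prod>v\<in>set p. class_poly m (count_list p v) ^ L v) * [:real m, 1:] ^ (n - total_length p L) =
    fit_poly m p L * [:real m, 1:] ^ (n - repeated_length p L)"
proof -
  have "(\<Prod>v\<in>set p. class_poly m (count_list p v) ^ L v) =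
      (\<Prod>v\<in>set p - repeated_vars p. class_poly m (count_list p v) ^ L v) * fit_poly m p L"
    unfolding fit_poly_def
    by (subst prod.subset_diff[of "repeated_vars p"]) (auto simp: repeated_vars_def)
  also have "(\<Prod>v\<in>set p - repeated_vars p. class_poly m (count_list p v) ^ L v) =
      (\<Prod>v\<in>set p - repeated_vars p. [:real m, 1:] ^ L v)"
    by (intro prod.cong) (auto simp: count_list_single class_poly_1)
  also have "\<dots> = [:real m, 1:] ^ (\<Sum>v\<in>set p - repeated_vars p. L v)"
    by (simp add: power_sum)
  finally have "(\<Prod>v\<in>set p. class_poly m (count_list p v) ^ L v) * [:real m, 1:] ^ (n - total_length p L) =
      fit_poly m p L * [:real m, 1:] ^ ((\<Sum>v\<in>set p - repeated_vars p. L v) + (n - total_length p L))"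
    by (simp add: power_add mult_ac)
  also have "(\<Sum>v\<in>set p - repeated_vars p. L v) + (n - total_length p L) = n - repeated_length p L"
    using assms total_length_split[of p L] by simp
  finally show ?thesis .
qed

lemma finite_repeated_divisions: "finite (repeated_divisions p n)"
proof -
  have le: "M v \<le> n" if "repeated_length p M \<le> n" "v \<in> repeated_vars p" for M v
  proof -
    have "1 * M v \<le> count_list p v * M v"
      using that by (intro mult_right_mono) (auto simp: repeated_vars_def)
    also have "\<dots> \<le> repeated_length p M"
      unfolding repeated_length_def using that by (intro member_le_sum) auto
    finally show ?thesis using that by simp
  qed
  have "repeated_divisions p n \<subseteq> repeated_vars p \<rightarrow>\<^sub>E {..n}"
  proof (rule subsetI)
    fix M assume "M \<in> repeated_divisions p n"
    then show "M \<in> repeated_vars p \<rightarrow>\<^sub>E {..n}"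
      using le[of M] by (simp add: repeated_divisions_def PiE_iff)
  qed
  then show ?thesis by (rule finite_subset) (auto intro!: finite_PiE)
qed

text \<open>Variables that occur once enter the total length with coefficient 1, so together with
  the position they share the room left by \<open>M\<close> exactly as in
  \<open>card_bounded_sums\<close>.\<close>

lemma card_divisions_fibre:
  assumes M: "M \<in> repeated_divisions p n"
  shows "card {(i, L) \<in> divisions p n. restrict L (repeated_vars p) = M} =
    Suc (n - repeated_length p M) choose Suc (card (set p - repeated_vars p))"
proof -
  let ?R = "repeated_vars p" and ?V = "set p - repeated_vars p"
  let ?N = "n - repeated_length p M"
  have sub: "?R \<subseteq> set p" by (auto simp: repeated_vars_def)
  have rl: "repeated_length p L = repeated_length p M" if "restrict L ?R = M" for L
    unfolding that[symmetric] by (simp add: repeated_length_def)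
  have MPi: "M \<in> ?R \<rightarrow>\<^sub>E {1..}" and le: "repeated_length p M \<le> n"
    using M by (auto simp: repeated_divisions_def)
  have "bij_betw (\<lambda>(i, L). (i, restrict L ?V)) {(i, L) \<in> divisions p n. restrict L ?R = M}
      {(i, S). S \<in> ?V \<rightarrow>\<^sub>E {1..} \<and> i + (\<Sum>v\<in>?V. S v) \<le> ?N}"
  proof (rule bij_betw_byWitness[where f' = "\<lambda>(i, S). (i, \<lambda>v. if v \<in> ?R then M v else S v)"])
    show "\<forall>x\<in>{(i, L) \<in> divisions p n. restrict L ?R = M}.
        (case case x of (i, L) \<Rightarrow> (i, restrict L ?V) of (i, S) \<Rightarrow> (i, \<lambda>v. if v \<in> ?R then M v else S v)) = x"
      by (auto simp: divisions_def fun_eq_iff PiE_iff extensional_def)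
    show "\<forall>x\<in>{(i, S). S \<in> ?V \<rightarrow>\<^sub>E {1..} \<and> i + (\<Sum>v\<in>?V. S v) \<le> ?N}.
        (case case x of (i, S) \<Rightarrow> (i, \<lambda>v. if v \<in> ?R then M v else S v) of (i, L) \<Rightarrow> (i, restrict L ?V)) = x"
      by (auto simp: fun_eq_iff PiE_iff extensional_def)
    show "(\<lambda>(i, L). (i, restrict L ?V)) ` {(i, L) \<in> divisions p n. restrict L ?R = M} \<subseteq>
        {(i, S). S \<in> ?V \<rightarrow>\<^sub>E {1..} \<and> i + (\<Sum>v\<in>?V. S v) \<le> ?N}"
    proof clarify
      fix i L assume L: "(i, L) \<in> divisions p n" "M = restrict L ?R"
      have "i + (repeated_length p M + (\<Sum>v\<in>?V. L v)) \<le> n"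
        using L(1) rl[OF L(2)[symmetric]] by (simp add: divisions_def total_length_split)
      then have "i + (\<Sum>v\<in>?V. restrict L ?V v) \<le> ?N" by simp
      with L show "restrict L ?V \<in> ?V \<rightarrow>\<^sub>E {1..} \<and>
          i + (\<Sum>v\<in>?V. restrict L ?V v) \<le> n - repeated_length p (restrict L ?R)"
        by (auto simp: divisions_def PiE_iff)
    qed
    show "(\<lambda>(i, S). (i, \<lambda>v. if v \<in> ?R then M v else S v)) `
        {(i, S). S \<in> ?V \<rightarrow>\<^sub>E {1..} \<and> i + (\<Sum>v\<in>?V. S v) \<le> ?N} \<subseteq>
        {(i, L) \<in> divisions p n. restrict L ?R = M}"
    proof clarify
      fix i S assume S: "S \<in> ?V \<rightarrow>\<^sub>E {1 :: nat..}" "i + (\<Sum>v\<in>?V. S v) \<le> ?N"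
      let ?L = "\<lambda>v. if v \<in> ?R then M v else S v"
      have r: "restrict ?L ?R = M"
        using MPi by (auto simp: fun_eq_iff PiE_iff extensional_def)
      have "total_length p ?L = repeated_length p M + (\<Sum>v\<in>?V. S v)"
        unfolding total_length_split rl[OF r] by simp
      then have "i + total_length p ?L \<le> n" using S(2) le by linarith
      moreover have "?L \<in> set p \<rightarrow>\<^sub>E {1..}"
        using S(1) MPi sub by (auto simp: PiE_iff extensional_def)
      ultimately show "(i, ?L) \<in> divisions p n \<and> restrict ?L ?R = M"
        using r by (simp add: divisions_def)
    qed
  qed
  then show ?thesis
    using card_bounded_sums[of ?V ?N] by (simp add: bij_betw_same_card)
qed

lemma sum_divisions:
  fixes F :: "('v \<Rightarrow> nat) \<Rightarrow> real"
  assumes "\<And>i L. (i, L) \<in> divisions p n \<Longrightarrow> G i L = F (restrict L (repeated_vars p))"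
  shows "(\<Sum>(i, L)\<in>divisions p n. G i L) =
    (\<Sum>M\<in>repeated_divisions p n.
      real (Suc (n - repeated_length p M) choose Suc (card (set p - repeated_vars p))) * F M)"
proof -
  let ?g = "\<lambda>(i :: nat, L :: 'v \<Rightarrow> nat). restrict L (repeated_vars p)"
  have "restrict L (repeated_vars p) \<in> repeated_divisions p n" if "(i, L) \<in> divisions p n" for i L
    using that by (auto simp: divisions_def repeated_divisions_def total_length_split PiE_iff
        repeated_vars_def repeated_length_def)
  then have "?g ` divisions p n \<subseteq> repeated_divisions p n" by auto
  then have "(\<Sum>(i, L)\<in>divisions p n. G i L) =
    (\<Sum>M\<in>repeated_divisions p n. \<Sum>(i, L)\<in>{x \<in> divisions p n. ?g x = M}. G i L)"
    by (intro sum.group[symmetric] finite_divisions finite_repeated_divisions)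
  also have "\<dots> = (\<Sum>M\<in>repeated_divisions p n.
      real (Suc (n - repeated_length p M) choose Suc (card (set p - repeated_vars p))) * F M)"
  proof (intro sum.cong refl)
    fix M assume M: "M \<in> repeated_divisions p n"
    have "{x \<in> divisions p n. ?g x = M} = {(i, L) \<in> divisions p n. restrict L (repeated_vars p) = M}"
      by auto
    moreover have "(\<Sum>(i, L)\<in>{x \<in> divisions p n. ?g x = M}. G i L) = (\<Sum>x\<in>{x \<in> divisions p n. ?g x = M}. F M)"
      by (intro sum.cong) (auto simp: assms)
    ultimately show "(\<Sum>(i, L)\<in>{x \<in> divisions p n. ?g x = M}. G i L) =
        real (Suc (n - repeated_length p M) choose Suc (card (set p - repeated_vars p))) * F M"
      by (simp add: card_divisions_fibre[OF M])
  qed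
  finally show ?thesis .
qed

lemma fit_poly_restrict: "fit_poly m p (restrict L (repeated_vars p)) = fit_poly m p L"
  by (simp add: fit_poly_def)

lemma repeated_length_restrict: "repeated_length p (restrict L (repeated_vars p)) = repeated_length p L"
  by (simp add: repeated_length_def)

text \<open>Fitting words divided by all words with \<open>h\<close> holes: a probability common to
  all divisions whose repeated lengths are \<open>M\<close>.\<close>

definition fit_prob :: "nat \<Rightarrow> 'v list \<Rightarrow> nat \<Rightarrow> nat \<Rightarrow> ('v \<Rightarrow> nat) \<Rightarrow> real" where
  "fit_prob m p n h M = coeff (fit_poly m p M * [:real m, 1:] ^ (n - repeated_length p M)) h /
    (real (n choose h) * real m ^ (n - h))"

lemma mean_occurrences_eq:
  assumes "0 < n" "real h = d * real n"
  shows "mean_occurrences TYPE('a::finite) p n d =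
    (\<Sum>M\<in>repeated_divisions p n.
      real (Suc (n - repeated_length p M) choose Suc (card (set p - repeated_vars p))) *
      fit_prob CARD('a) p n h M)"
proof -
  let ?F = "\<lambda>M. coeff (fit_poly CARD('a) p M * [:real CARD('a), 1:] ^ (n - repeated_length p M)) h"
  have "(pwords n d :: 'a pword set) = {w. length w = n \<and> holes w = h}"
    using assms by (auto simp: pwords_def hole_density_def field_simps)
  then have "(\<Sum>w\<in>(pwords n d :: 'a pword set). real (card (occurrences p w))) =
    (\<Sum>(i, L)\<in>divisions p n. coeff ((\<Prod>v\<in>set p. class_poly CARD('a) (count_list p v) ^ L v) *
      [:real CARD('a), 1:] ^ (n - total_length p L)) h)"
    by (simp add: sum_card_occurrences)
  also have "\<dots> = (\<Sum>M\<in>repeated_divisions p n.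
      real (Suc (n - repeated_length p M) choose Suc (card (set p - repeated_vars p))) * ?F M)"
    by (rule sum_divisions, subst prod_class_poly_split)
      (auto simp: divisions_def fit_poly_restrict repeated_length_restrict)
  finally show ?thesis
    unfolding mean_occurrences_def card_pwords[OF assms] fit_prob_def
    by (simp add: sum_divide_distrib)
qed

subsection \<open>Asymptotics\<close>

text \<open>The rate \<open>q\<close> of the overview. For independent characters,
  \<open>d + (1 - d) / m\<close> is the probability of being a hole or one given letter; summing
  over the letters counts the all-hole event, of probability \<open>d ^ k\<close>, \<open>m\<close>
  times.\<close>

definition fit_rate :: "nat \<Rightarrow> real \<Rightarrow> nat \<Rightarrow> real" where
  "fit_rate m d k = real m * (d + (1 - d) / real m) ^ k - (real m - 1) * d ^ k"

lemma fit_rate_1: "0 < m \<Longrightarrow> fit_rate m d (Suc 0) = 1"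
  by (simp add: fit_rate_def field_simps)

text \<open>Replacing \<open>d ^ k\<close> by the larger power of \<open>d + (1 - d) / m\<close>
  still leaves one copy of that power.\<close>

lemma fit_rate_pos:
  assumes "1 \<le> m" "0 < d" "d < 1"
  shows "0 < fit_rate m d k"
proof -
  have "(real m - 1) * d ^ k \<le> (real m - 1) * (d + (1 - d) / real m) ^ k"
    using assms by (intro mult_left_mono power_mono) auto
  moreover have "0 < (d + (1 - d) / real m) ^ k"
    using assms by (intro zero_less_power add_pos_nonneg) auto
  ultimately show ?thesis by (simp add: fit_rate_def algebra_simps)
qed

text \<open>With \<open>u = d + (1 - d) / m\<close>, the coefficients \<open>m (1 - u)\<close> and
  \<open>(m - 1) (1 - d)\<close> of the two powers coincide. The sign of the difference can then be
  read off from \<open>d < u\<close>.\<close>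

lemma fit_rate_Suc:
  assumes "0 < m"
  shows "fit_rate m d k - fit_rate m d (Suc k) =
    (real m - 1) * (1 - d) * ((d + (1 - d) / real m) ^ k - d ^ k)"
proof -
  define u where "u = d + (1 - d) / real m"
  have u: "real m * (1 - u) = (real m - 1) * (1 - d)"
    using assms by (simp add: u_def field_simps)
  have "fit_rate m d k - fit_rate m d (Suc k) =
      (real m * (1 - u)) * u ^ k - (real m - 1) * (1 - d) * d ^ k"
    unfolding fit_rate_def u_def[symmetric] by (simp add: algebra_simps)
  then show ?thesis
    unfolding u u_def[symmetric] by (simp add: algebra_simps)
qed

text \<open>The rate equals 1 at \<open>k = 1\<close> and strictly decreases from there. Two letters
  are essential: for \<open>m = 1\<close> it is constantly 1.\<close>

lemma fit_rate_less_1: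
  assumes "2 \<le> m" "0 < d" "d < 1" "1 < k"
  shows "fit_rate m d k < 1"
proof -
  have less: "fit_rate m d (Suc k) < fit_rate m d k" if "0 < k" for k
  proof -
    have "d ^ k < (d + (1 - d) / real m) ^ k"
      using assms that by (intro power_strict_mono) auto
    then have "0 < (real m - 1) * (1 - d) * ((d + (1 - d) / real m) ^ k - d ^ k)"
      using assms by simp
    then show ?thesis using fit_rate_Suc[of m d k] assms by linarith
  qed
  have "fit_rate m d (Suc (Suc j)) < 1" for j
  proof (induction j)
    case 0
    then show ?case using less[of 1] fit_rate_1[of m d] assms by simp
  next
    case (Suc j)
    then show ?case using less[of "Suc (Suc j)"] by simp
  qed
  from this[of "k - 2"] show ?thesis using assms
    by (metis add_2_eq_Suc le_add_diff_inverse nat_1_add_1 plus_1_eq_Suc Suc_leI)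
qed

text \<open>The evaluation point is the quotient of the probability \<open>d\<close> of a hole and
  the probability \<open>(1 - d) / m\<close> of a given letter. Scaling by the latter to the power
  \<open>T\<close> turns the generating polynomial into the probability for independent
  characters.\<close>

lemma sum_coeff_eq_poly:
  assumes "degree A \<le> T" "0 < m" "d < 1"
  shows "(\<Sum>a\<le>T. coeff A a / real m ^ (T - a) * (d ^ a * (1 - d) ^ (T - a))) =
    poly A (real m * d / (1 - d)) * ((1 - d) / real m) ^ T"
proof -
  have "poly A (real m * d / (1 - d)) = (\<Sum>a\<le>T. coeff A a * (real m * d / (1 - d)) ^ a)"
    unfolding poly_altdef using assms(1) by (intro sum.mono_neutral_left) (auto simp: coeff_eq_0)
  moreover have "coeff A a / real m ^ (T - a) * (d ^ a * (1 - d) ^ (T - a)) =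
      coeff A a * (real m * d / (1 - d)) ^ a * ((1 - d) / real m) ^ T" if "a \<le> T" for a
  proof -
    let ?y = "real m * d / (1 - d)" and ?w = "(1 - d) / real m"
    have "?w ^ T = ?w ^ a * ?w ^ (T - a)"
      using that by (simp flip: power_add)
    then have "coeff A a * ?y ^ a * ?w ^ T = coeff A a * (?y * ?w) ^ a * ?w ^ (T - a)"
      by (simp only: power_mult_distrib mult_ac)
    also have "?y * ?w = d" using assms by simp
    finally show ?thesis by (simp add: power_divide)
  qed
  ultimately show ?thesis by (simp add: sum_distrib_right)
qed

lemma poly_class_poly_eq_fit_rate:
  assumes "0 < m" "d < 1"
  shows "poly (class_poly m k) (real m * d / (1 - d)) * ((1 - d) / real m) ^ k = fit_rate m d k"
proof -
  have 1: "(1 + real m * d / (1 - d)) * ((1 - d) / real m) = d + (1 - d) / real m"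
    and 2: "real m * d / (1 - d) * ((1 - d) / real m) = d"
    using assms by (simp_all add: field_simps)
  have "poly (class_poly m k) (real m * d / (1 - d)) * ((1 - d) / real m) ^ k =
    real m * ((1 + real m * d / (1 - d)) * ((1 - d) / real m)) ^ k -
    (real m - 1) * (real m * d / (1 - d) * ((1 - d) / real m)) ^ k"
    unfolding poly_class_poly power_mult_distrib by (simp only: left_diff_distrib mult.assoc)
  then show ?thesis unfolding 1 2 by (simp add: fit_rate_def)
qed

definition fit_limit :: "nat \<Rightarrow> real \<Rightarrow> 'v list \<Rightarrow> ('v \<Rightarrow> nat) \<Rightarrow> real" where
  "fit_limit m d p M = (\<Prod>v\<in>repeated_vars p. fit_rate m d (count_list p v) ^ M v)"

lemma degree_fit_poly: "degree (fit_poly m p M) \<le> repeated_length p M"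
proof -
  have "degree (fit_poly m p M) \<le> (\<Sum>v\<in>repeated_vars p. degree (class_poly m (count_list p v) ^ M v))"
    unfolding fit_poly_def by (rule order_trans[OF degree_prod_sum_le]) auto
  also have "\<dots> \<le> repeated_length p M"
    unfolding repeated_length_def
    by (intro sum_mono order_trans[OF degree_power_le] mult_right_mono degree_class_poly) auto
  finally show ?thesis .
qed

lemma poly_fit_poly:
  assumes "0 < m" "d < 1"
  shows "poly (fit_poly m p M) (real m * d / (1 - d)) * ((1 - d) / real m) ^ repeated_length p M =
    fit_limit m d p M"
proof -
  have "((1 - d) / real m) ^ repeated_length p M =
      (\<Prod>v\<in>repeated_vars p. (((1 - d) / real m) ^ count_list p v) ^ M v)"
    by (simp add: repeated_length_def power_sum power_mult)
  then show ?thesis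
    unfolding fit_limit_def fit_poly_def
    by (simp add: poly_prod prod.distrib[symmetric] power_mult_distrib[symmetric]
        poly_class_poly_eq_fit_rate[OF assms] del: times_divide_eq_left times_divide_eq_right)
qed

lemma fit_prob_eq_sum:
  assumes "1 \<le> m" "h \<le> n" "repeated_length p M \<le> n"
  shows "fit_prob m p n h M = (\<Sum>a\<le>repeated_length p M.
    coeff (fit_poly m p M) a / real m ^ (repeated_length p M - a) * hyp_ratio n h (repeated_length p M) a)"
  unfolding fit_prob_def using assms by (intro coeff_mult_linear_power degree_fit_poly)

section \<open>Bounds and limit of the probability of fitting\<close>

lemma coeffs_le_fit_poly:
  assumes "1 \<le> m"
  shows "coeffs_le (fit_poly m p M) (fit_poly m p M)"
  unfolding fit_poly_def
  by (intro coeffs_le_prod coeffs_le_power coeffs_le_refl[OF coeffs_le_class_poly[OF assms]])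

lemma fit_prob_nonneg:
  assumes "1 \<le> m"
  shows "0 \<le> fit_prob m p n h M"
proof -
  have "coeffs_le [:real m, 1:] [:real m, 1:]"
    by (auto simp: coeffs_le_def coeff_pCons split: nat.splits)
  then have "coeffs_le (fit_poly m p M * [:real m, 1:] ^ (n - repeated_length p M))
      (fit_poly m p M * [:real m, 1:] ^ (n - repeated_length p M))"
    by (intro coeffs_le_mult coeffs_le_fit_poly coeffs_le_power assms)
  then show ?thesis by (simp add: fit_prob_def coeffs_le_def)
qed

text \<open>Shortening blocks turns whole classes into free positions, that is, factors
  \<open>class_poly m k\<close> into \<open>(X + m) ^ k\<close>. The comparison is made between
  coefficients because the blocks of \<open>M\<close> and \<open>M'\<close> lie at different
  positions, so there is no evident inclusion between the sets of fitting words.\<close>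

lemma fit_prob_antimono:
  assumes m: "1 \<le> m" and le: "\<And>v. M' v \<le> M v" and n: "repeated_length p M \<le> n"
  shows "fit_prob m p n h M \<le> fit_prob m p n h M'"
proof -
  let ?N = "\<lambda>M. repeated_length p M"
  define D where "D v = M v - M' v" for v
  have M: "M v = M' v + D v" for v using le by (simp add: D_def)
  have N: "?N M = ?N M' + (\<Sum>v\<in>repeated_vars p. count_list p v * D v)"
    by (simp add: repeated_length_def M sum.distrib algebra_simps)
  have X: "coeffs_le [:real m, 1:] [:real m, 1:]"
    by (auto simp: coeffs_le_def coeff_pCons split: nat.splits)
  have "fit_poly m p M = fit_poly m p M' * (\<Prod>v\<in>repeated_vars p. class_poly m (count_list p v) ^ D v)"
    by (simp add: fit_poly_def M power_add prod.distrib)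
  moreover have "coeffs_le (\<Prod>v\<in>repeated_vars p. class_poly m (count_list p v) ^ D v)
      (\<Prod>v\<in>repeated_vars p. ([:real m, 1:] ^ count_list p v) ^ D v)"
    by (intro coeffs_le_prod coeffs_le_power coeffs_le_class_poly m)
  moreover have "(\<Prod>v\<in>repeated_vars p. ([:real m, 1:] ^ count_list p v) ^ D v) =
      [:real m, 1:] ^ (\<Sum>v\<in>repeated_vars p. count_list p v * D v)"
    by (simp add: power_sum power_mult)
  ultimately have "coeffs_le (fit_poly m p M * [:real m, 1:] ^ (n - ?N M))
      (fit_poly m p M' * [:real m, 1:] ^ (\<Sum>v\<in>repeated_vars p. count_list p v * D v) * [:real m, 1:] ^ (n - ?N M))"
    by (simp only:) (intro coeffs_le_mult coeffs_le_power coeffs_le_fit_poly X m)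
  also have "fit_poly m p M' * [:real m, 1:] ^ (\<Sum>v\<in>repeated_vars p. count_list p v * D v) * [:real m, 1:] ^ (n - ?N M) =
      fit_poly m p M' * [:real m, 1:] ^ (n - ?N M')"
  proof -
    have "(\<Sum>v\<in>repeated_vars p. count_list p v * D v) + (n - ?N M) = n - ?N M'"
      using N n by linarith
    then show ?thesis by (simp only: mult.assoc flip: power_add)
  qed
  finally show ?thesis
    unfolding fit_prob_def coeffs_le_def by (intro divide_right_mono) auto
qed

text \<open>The coefficients are nonnegative, so \<open>hyp_ratio_le\<close> applies term by term;
  the inflation factor does not depend on the number of holes and comes out of the sum.\<close>

lemma fit_prob_le_small:
  assumes "1 \<le> m" "0 < n" "real h = d * real n" "0 < d" "d < 1" "2 \<le> D" "D * repeated_length p M \<le> n"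
  shows "fit_prob m p n h M \<le> (real D / (real D - 1)) ^ repeated_length p M * fit_limit m d p M"
proof -
  let ?T = "repeated_length p M"
  have m0: "0 < m" using assms by simp
  have "?T \<le> D * ?T" using assms by simp
  then have T: "?T \<le> n" using assms by linarith
  have h: "h \<le> n"
  proof -
    have "real h \<le> 1 * real n" unfolding assms(3) using assms by (intro mult_right_mono) auto
    then show ?thesis by simp
  qed
  have nonneg: "0 \<le> coeff (fit_poly m p M) a" for a
    using coeffs_le_fit_poly[OF assms(1), of p M] by (simp add: coeffs_le_def)
  have "fit_prob m p n h M \<le> (\<Sum>a\<le>?T. coeff (fit_poly m p M) a / real m ^ (?T - a) *
      ((real D / (real D - 1)) ^ ?T * (d ^ a * (1 - d) ^ (?T - a))))"
    unfolding fit_prob_eq_sum[OF assms(1) h T]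
    using assms nonneg by (intro sum_mono mult_left_mono hyp_ratio_le) auto
  also have "\<dots> = (real D / (real D - 1)) ^ ?T *
      (\<Sum>a\<le>?T. coeff (fit_poly m p M) a / real m ^ (?T - a) * (d ^ a * (1 - d) ^ (?T - a)))"
    by (simp add: sum_distrib_left mult_ac)
  also have "\<dots> = (real D / (real D - 1)) ^ ?T * fit_limit m d p M"
    unfolding sum_coeff_eq_poly[OF degree_fit_poly m0 assms(5)] poly_fit_poly[OF m0 assms(5)] ..
  finally show ?thesis .
qed

text \<open>The hypergeometric ratios are only controlled on a small fraction of the word, so the
  lengths are first divided by a large constant, which only increases the probability.\<close>
lemma fit_prob_le:
  assumes "1 \<le> m" "0 < n" "real h = d * real n" "0 < d" "d < 1" "2 \<le> D" "repeated_length p M \<le> n"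
  shows "fit_prob m p n h M \<le>
    (\<Prod>v\<in>repeated_vars p. ((real D / (real D - 1)) ^ count_list p v * fit_rate m d (count_list p v)) ^ (M v div D))"
proof -
  let ?M' = "\<lambda>v. M v div D"
  have "D * repeated_length p ?M' = (\<Sum>v\<in>repeated_vars p. count_list p v * (D * (M v div D)))"
    by (simp add: repeated_length_def sum_distrib_left mult_ac)
  also have "\<dots> \<le> repeated_length p M"
    unfolding repeated_length_def by (intro sum_mono mult_left_mono) auto
  finally have le: "D * repeated_length p ?M' \<le> n" using assms by linarith
  have "fit_prob m p n h M \<le> fit_prob m p n h ?M'"
    using assms by (intro fit_prob_antimono) auto
  also have "\<dots> \<le> (real D / (real D - 1)) ^ repeated_length p ?M' * fit_limit m d p ?M'"
    using assms le by (intro fit_prob_le_small)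
  also have "\<dots> = (\<Prod>v\<in>repeated_vars p. ((real D / (real D - 1)) ^ count_list p v * fit_rate m d (count_list p v)) ^ (M v div D))"
    by (simp add: fit_limit_def repeated_length_def power_sum power_mult power_mult_distrib prod.distrib)
  finally show ?thesis .
qed

text \<open>For fixed \<open>M\<close> the number of terms does not depend on \<open>n\<close>, so
  the limit may be taken in each hypergeometric ratio separately.\<close>

lemma tendsto_fit_prob:
  assumes "1 \<le> m" "0 < d" "d < 1" and F: "F \<le> sequentially"
    and h: "\<forall>\<^sub>F n in F. real (h n) = d * real n"
  shows "((\<lambda>n. fit_prob m p n (h n) M) \<longlongrightarrow> fit_limit m d p M) F"
proof -
  let ?T = "repeated_length p M"
  have m0: "0 < m" using assms by simp
  have "((\<lambda>n. \<Sum>a\<le>?T. coeff (fit_poly m p M) a / real m ^ (?T - a) * hyp_ratio n (h n) ?T a) \<longlongrightarrow>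
    (\<Sum>a\<le>?T. coeff (fit_poly m p M) a / real m ^ (?T - a) * (d ^ a * (1 - d) ^ (?T - a)))) F"
    by (intro tendsto_sum tendsto_mult_left tendsto_hyp_ratio h F) auto
  also have "(\<Sum>a\<le>?T. coeff (fit_poly m p M) a / real m ^ (?T - a) * (d ^ a * (1 - d) ^ (?T - a))) =
      fit_limit m d p M"
    unfolding sum_coeff_eq_poly[OF degree_fit_poly m0 assms(3)] poly_fit_poly[OF m0 assms(3)] ..
  finally show ?thesis
  proof (rule Lim_transform_eventually)
    show "\<forall>\<^sub>F n in F. (\<Sum>a\<le>?T. coeff (fit_poly m p M) a / real m ^ (?T - a) * hyp_ratio n (h n) ?T a) =
        fit_prob m p n (h n) M"
      using h filter_leD[OF F eventually_ge_at_top[of ?T]]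
    proof eventually_elim
      case (elim n)
      have "real (h n) \<le> 1 * real n" unfolding elim(1) using assms by (intro mult_right_mono) auto
      then show ?case using fit_prob_eq_sum[of m "h n" n p M] assms elim by simp
    qed
  qed
qed

section \<open>The binomial factor and the passage to the limit\<close>

lemma binomial_eq_prod: "real (N choose r) = (\<Prod>i<r. real N - real i) / fact r"
  by (simp add: binomial_gbinomial gbinomial_prod_rev lessThan_atLeast0)

lemma tendsto_choose_ratio:
  "(\<lambda>n. real (Suc (n - T) choose r) / (real n ^ r / fact r)) \<longlonglongrightarrow> 1"
proof -
  have "(\<lambda>n. \<Prod>i<r. (real n - real T + 1 - real i) / real n) \<longlonglongrightarrow> (\<Prod>i<r. 1)"
  proof (intro tendsto_prod)
    fix i show "(\<lambda>n. (real n - real T + 1 - real i) / real n) \<longlonglongrightarrow> 1" by real_asymp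
  qed
  moreover have "\<forall>\<^sub>F n in sequentially. (\<Prod>i<r. (real n - real T + 1 - real i) / real n) =
      real (Suc (n - T) choose r) / (real n ^ r / fact r)"
    using eventually_ge_at_top[of T]
    by eventually_elim (simp add: binomial_eq_prod prod_dividef of_nat_diff algebra_simps)
  ultimately show ?thesis by (simp add: tendsto_cong)
qed

lemma choose_ratio_le:
  assumes "0 < n"
  shows "real (Suc (n - T) choose r) / (real n ^ r / fact r) \<le> 2 ^ r"
proof -
  have "real (Suc (n - T) choose r) * fact r \<le> real (Suc (n - T)) ^ r"
  proof (cases "r \<le> Suc (n - T)")
    case True
    then have "(\<Prod>i<r. real (Suc (n - T)) - real i) \<le> (\<Prod>i<r. real (Suc (n - T)))"
      by (intro prod_mono) auto
    then show ?thesis by (simp add: binomial_eq_prod)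
  qed (simp add: binomial_eq_0)
  \<comment> \<open>Here \<open>Suc (n - T) \<le> n + 1 \<le> 2 * n\<close>, the source of the
    constant 2 in the dominating series.\<close>
  also have "\<dots> \<le> (2 * real n) ^ r"
    using assms by (intro power_mono) auto
  finally show ?thesis using assms by (simp add: field_simps power_mult_distrib)
qed

lemma mean_occurrences_tendsto:
  fixes p :: "'v list" and d :: real
  defines "F \<equiv> inf sequentially (principal {n. d * real n \<in> \<int>})"
  defines "m \<equiv> CARD('a::finite)"
  defines "s \<equiv> card (set p - repeated_vars p)"
  assumes d: "0 < d" "d < 1" and m2: "repeated_vars p \<noteq> {} \<Longrightarrow> 2 \<le> m"
  shows "((\<lambda>n. mean_occurrences TYPE('a) p n d / (real n ^ Suc s / fact (Suc s))) \<longlongrightarrow>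
    (\<Prod>v\<in>repeated_vars p. fit_rate m d (count_list p v) / (1 - fit_rate m d (count_list p v)))) F"
proof -
  let ?R = "repeated_vars p" and ?q = "\<lambda>v. fit_rate m d (count_list p v)"
  let ?A = "?R \<rightarrow>\<^sub>E {1 :: nat..}"
  have m1: "1 \<le> m" by (simp add: m_def Suc_le_eq)
  have q: "0 < ?q v" "?q v < 1" if "v \<in> ?R" for v
    using that fit_rate_pos[OF m1 d] fit_rate_less_1[OF m2 d] by (auto simp: repeated_vars_def)
  \<comment> \<open>The floor is a total way to write \<open>d * n\<close>; it is exact along the
    filter \<open>F\<close>.\<close>
  define h where "h n = nat \<lfloor>d * real n\<rfloor>" for n :: nat
  have F: "F \<le> sequentially" by (simp add: F_def)
  have h: "\<forall>\<^sub>F n in F. real (h n) = d * real n"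
    unfolding F_def eventually_inf_principal
  proof (intro always_eventually allI impI)
    fix n :: nat assume "n \<in> {n. d * real n \<in> \<int>}"
    then show "real (h n) = d * real n" using d by (auto simp: h_def elim!: Ints_cases)
  qed
  have pos: "\<forall>\<^sub>F n in F. 0 < n" by (rule filter_leD[OF F eventually_gt_at_top])
  \<comment> \<open>Extension by zero replaces the finite index set, which grows with
    \<open>n\<close>, by the fixed set \<open>?A\<close>, as dominated convergence requires.\<close>
  define t where "t M n = (if repeated_length p M \<le> n then
      real (Suc (n - repeated_length p M) choose Suc s) / (real n ^ Suc s / fact (Suc s)) *
      fit_prob m p n (h n) M else 0)" for M n
  \<comment> \<open>As \<open>D / (D - 1)\<close> tends to 1 and each rate is strictly below 1, one
    large \<open>D\<close> serves all of the finitely many repeated variables.\<close>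
  obtain D :: nat where D: "2 \<le> D"
    and \<rho>: "\<And>v. v \<in> ?R \<Longrightarrow> (real D / (real D - 1)) ^ count_list p v * ?q v < 1"
  proof -
    have "\<forall>\<^sub>F D in sequentially. (real D / (real D - 1)) ^ count_list p v * ?q v < 1" if "v \<in> ?R" for v
    proof (rule order_tendstoD(2))
      have "(\<lambda>D. real D / (real D - 1)) \<longlonglongrightarrow> 1" by real_asymp
      then show "(\<lambda>D. (real D / (real D - 1)) ^ count_list p v * ?q v) \<longlonglongrightarrow> 1 ^ count_list p v * ?q v"
        by (intro tendsto_intros)
      show "1 ^ count_list p v * ?q v < 1" using q that by simp
    qed
    then have "\<forall>\<^sub>F D in sequentially. \<forall>v\<in>?R. (real D / (real D - 1)) ^ count_list p v * ?q v < 1"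
      by (intro eventually_ball_finite) auto
    then have "\<forall>\<^sub>F D in sequentially. 2 \<le> D \<and> (\<forall>v\<in>?R. (real D / (real D - 1)) ^ count_list p v * ?q v < 1)"
      using eventually_ge_at_top[of 2] by eventually_elim auto
    then obtain D where "2 \<le> D \<and> (\<forall>v\<in>?R. (real D / (real D - 1)) ^ count_list p v * ?q v < 1)"
      using eventually_happens'[OF sequentially_bot] by blast
    then show ?thesis by (intro that[of D]) auto
  qed
  \<comment> \<open>The value 0 outside \<open>?R\<close> makes the summands nonnegative for every
    \<open>v\<close>, as \<open>summable_on_prod_PiE\<close> demands.\<close>
  define \<rho> where "\<rho> v = (if v \<in> ?R then (real D / (real D - 1)) ^ count_list p v * ?q v else 0)" for v
  have \<rho>_bounds: "0 < \<rho> v" "\<rho> v < 1" if "v \<in> ?R" for v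
    using that q \<rho> D by (auto simp: \<rho>_def)
  have "(\<lambda>M. \<Prod>v\<in>?R. \<rho> v ^ (M v div D)) summable_on ?A"
  proof (rule summable_on_prod_PiE[where f = "\<lambda>v l. \<rho> v ^ (l div D)"])
    show "(\<lambda>l. \<rho> v ^ (l div D)) summable_on {1..}" if "v \<in> ?R" for v
      using \<rho>_bounds[OF that] D by (intro summable_on_power_div) auto
    show "0 \<le> \<rho> v ^ (l div D)" for v l
      using \<rho>_bounds[of v] by (cases "v \<in> ?R") (auto simp: \<rho>_def)
  qed simp
  then have summable: "(\<lambda>M. 2 ^ Suc s * (\<Prod>v\<in>?R. \<rho> v ^ (M v div D))) summable_on ?A"
    by (rule summable_on_cmult_right)
  have "((\<lambda>n. \<Sum>\<^sub>\<infinity>M\<in>?A. t M n) \<longlongrightarrow> (\<Sum>\<^sub>\<infinity>M\<in>?A. fit_limit m d p M)) F"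
  proof (rule tendsto_infsum_dominated[OF _ _ summable])
    fix M
    have "((\<lambda>n. real (Suc (n - repeated_length p M) choose Suc s) / (real n ^ Suc s / fact (Suc s)) *
        fit_prob m p n (h n) M) \<longlongrightarrow> 1 * fit_limit m d p M) F"
      by (intro tendsto_mult tendsto_mono[OF F tendsto_choose_ratio] tendsto_fit_prob m1 d F h)
    moreover have "\<forall>\<^sub>F n in F. real (Suc (n - repeated_length p M) choose Suc s) / (real n ^ Suc s / fact (Suc s)) *
        fit_prob m p n (h n) M = t M n"
      using filter_leD[OF F eventually_ge_at_top[of "repeated_length p M"]]
      by eventually_elim (simp add: t_def)
    ultimately show "(t M \<longlongrightarrow> fit_limit m d p M) F"
      by (simp add: tendsto_cong)
  next
    show "\<forall>\<^sub>F n in F. \<forall>M\<in>?A. norm (t M n) \<le> 2 ^ Suc s * (\<Prod>v\<in>?R. \<rho> v ^ (M v div D))"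
      using h pos
    proof eventually_elim
      case (elim n)
      show ?case
      proof
        fix M
        have \<rho>_nonneg: "0 \<le> (\<Prod>v\<in>?R. \<rho> v ^ (M v div D))"
          using \<rho>_bounds by (intro prod_nonneg) (auto simp: less_imp_le)
        show "norm (t M n) \<le> 2 ^ Suc s * (\<Prod>v\<in>?R. \<rho> v ^ (M v div D))"
        proof (cases "repeated_length p M \<le> n")
          case True
          have "fit_prob m p n (h n) M \<le> (\<Prod>v\<in>?R. \<rho> v ^ (M v div D))"
            using fit_prob_le[OF m1 elim(2,1) d D True] by (simp add: \<rho>_def)
          then have "t M n \<le> 2 ^ Suc s * (\<Prod>v\<in>?R. \<rho> v ^ (M v div D))"
            unfolding t_def if_P[OF True]
            by (intro mult_mono choose_ratio_le elim fit_prob_nonneg m1) auto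
          moreover have "0 \<le> t M n"
            using fit_prob_nonneg[OF m1, of p n "h n" M] by (simp add: t_def)
          ultimately show ?thesis by simp
        next
          case False
          then show ?thesis using \<rho>_nonneg by (simp add: t_def)
        qed
      qed
    qed
  qed
  moreover have "\<forall>\<^sub>F n in F. (\<Sum>\<^sub>\<infinity>M\<in>?A. t M n) =
      mean_occurrences TYPE('a) p n d / (real n ^ Suc s / fact (Suc s))"
    using h pos
  proof eventually_elim
    case (elim n)
    have "(\<Sum>\<^sub>\<infinity>M\<in>?A. t M n) = (\<Sum>\<^sub>\<infinity>M\<in>repeated_divisions p n. t M n)"
      by (intro infsum_cong_neutral) (auto simp: repeated_divisions_def t_def)
    also have "\<dots> = (\<Sum>M\<in>repeated_divisions p n. t M n)"
      by (simp add: finite_repeated_divisions)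
    also have "\<dots> = mean_occurrences TYPE('a) p n d / (real n ^ Suc s / fact (Suc s))"
      unfolding mean_occurrences_eq[OF elim(2,1)] sum_divide_distrib m_def[symmetric] s_def[symmetric]
      by (intro sum.cong) (auto simp: repeated_divisions_def t_def)
    finally show ?case .
  qed
  moreover have "(\<Sum>\<^sub>\<infinity>M\<in>?A. fit_limit m d p M) = (\<Prod>v\<in>?R. ?q v / (1 - ?q v))"
    unfolding fit_limit_def using q by (intro infsum_prod_geometric) (auto simp: less_imp_le)
  ultimately show ?thesis by (simp add: tendsto_cong)
qed

text \<open>Since \<open>1 + d (m - 1)\<close> is \<open>m\<close> times
  \<open>d + (1 - d) / m\<close>, a power of \<open>m\<close> factors out. The same power appears in
  the denominator of the theorem, so each factor reduces to \<open>q / (1 - q)\<close>.\<close>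

lemma fit_rate_scaled:
  assumes "0 < m" "0 < k"
  shows "(1 + d * (real m - 1)) ^ k - (1 - 1 / real m) * (real m * d) ^ k = real m ^ (k - 1) * fit_rate m d k"
proof -
  have mk: "real m ^ k = real m * real m ^ (k - 1)"
    using assms by (simp flip: power_Suc)
  have "1 + d * (real m - 1) = real m * (d + (1 - d) / real m)"
    using assms by (simp add: field_simps)
  then have "(1 + d * (real m - 1)) ^ k = real m ^ (k - 1) * (real m * (d + (1 - d) / real m) ^ k)"
    by (simp add: power_mult_distrib mk)
  moreover have "(1 - 1 / real m) * (real m * d) ^ k = real m ^ (k - 1) * ((real m - 1) * d ^ k)"
    using assms by (simp add: power_mult_distrib mk field_simps)
  ultimately show ?thesis by (simp add: fit_rate_def algebra_simps)
qed

text \<open>Over a one-letter alphabet every word fits every division, and a repeated variable would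
  contribute the factor \<open>1 / 0\<close>; \<open>nondegenerate\<close> excludes this
  case.\<close>

theorem theorem10:
  fixes p :: "'v list" and x :: "nat \<Rightarrow> 'v" and k :: "nat \<Rightarrow> nat"
    and r s m :: nat and d :: real
  assumes vars: "bij_betw x {1..r} (set p)"
    and occs: "\<And>j. j \<in> {1..r} \<Longrightarrow> k j = count_list p (x j)"
    and s_le: "s \<le> r"
    and once: "\<And>j. j \<in> {1..s} \<Longrightarrow> k j = 1"
    and repeated: "\<And>j. j \<in> {s+1..r} \<Longrightarrow> 1 < k j"
    and sorted: "\<And>i j. s + 1 \<le> i \<Longrightarrow> i \<le> j \<Longrightarrow> j \<le> r \<Longrightarrow> k i \<le> k j"
    and d: "d \<in> \<rat>" "0 < d" "d < 1"
    and m: "m = CARD('a::finite)"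
    and nondegenerate: "s < r \<Longrightarrow> 2 \<le> m"
  shows "(\<lambda>n. mean_occurrences TYPE('a) p n d)
    \<sim>[inf sequentially (principal {n. d * real n \<in> \<int>})]
    (\<lambda>n. real n ^ (s + 1) / fact (s + 1) *
      (\<Prod>j\<in>{s+1..r}.
        ((1 + d * (real m - 1)) ^ k j - (1 - 1 / real m) * (real m * d) ^ k j) /
        (real m ^ (k j - 1) - (1 + d * (real m - 1)) ^ k j
          + (1 - 1 / real m) * (real m * d) ^ k j)))"
proof -
  let ?q = "\<lambda>v. fit_rate m d (count_list p v)"
  let ?P = "\<Prod>v\<in>repeated_vars p. ?q v / (1 - ?q v)"
  have m1: "0 < m" by (simp add: m)
  have inj: "inj_on x {1..r}" and img: "set p = x ` {1..r}"
    using vars by (auto simp: bij_betw_def)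
  have R: "repeated_vars p = x ` {s+1..r}"
  proof (intro set_eqI iffI)
    fix v assume "v \<in> repeated_vars p"
    then obtain j where j: "j \<in> {1..r}" "v = x j" "1 < k j"
      unfolding repeated_vars_def img using occs by auto
    then have "j \<notin> {1..s}" using once[of j] by auto
    with j show "v \<in> x ` {s+1..r}" by (intro image_eqI[of _ _ j]) auto
  next
    fix v assume "v \<in> x ` {s+1..r}"
    then obtain j where "j \<in> {s+1..r}" "v = x j" by auto
    then show "v \<in> repeated_vars p"
      using repeated[of j] occs[of j] unfolding repeated_vars_def img by auto
  qed
  have inj': "inj_on x {s+1..r}" by (rule inj_on_subset[OF inj]) auto
  have "card (set p - repeated_vars p) = card (set p) - card (repeated_vars p)"
    by (rule card_Diff_subset) (auto simp: repeated_vars_def)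
  also have "\<dots> = s"
    unfolding R img card_image[OF inj] card_image[OF inj'] using s_le by simp
  finally have s: "card (set p - repeated_vars p) = s" .
  have m2: "2 \<le> m" if "repeated_vars p \<noteq> {}"
    using that nondegenerate unfolding R by auto
  have q: "0 < ?q v" "?q v < 1" if "v \<in> repeated_vars p" for v
    using that fit_rate_pos[of m d] m1 d fit_rate_less_1[OF m2 d(2,3)] by (auto simp: repeated_vars_def Suc_le_eq)
  have "(\<Prod>j\<in>{s+1..r}.
        ((1 + d * (real m - 1)) ^ k j - (1 - 1 / real m) * (real m * d) ^ k j) /
        (real m ^ (k j - 1) - (1 + d * (real m - 1)) ^ k j + (1 - 1 / real m) * (real m * d) ^ k j)) =
      (\<Prod>j\<in>{s+1..r}. ?q (x j) / (1 - ?q (x j)))"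
  proof (intro prod.cong refl)
    fix j assume j: "j \<in> {s+1..r}"
    then have k: "0 < k j" and kx: "count_list p (x j) = k j"
      using repeated[of j] occs[of j] by auto
    \<comment> \<open>The denominator is bracketed so that the numerator reappears in it and
      \<open>fit_rate_scaled\<close> rewrites both.\<close>
    have "((1 + d * (real m - 1)) ^ k j - (1 - 1 / real m) * (real m * d) ^ k j) /
        (real m ^ (k j - 1) - ((1 + d * (real m - 1)) ^ k j - (1 - 1 / real m) * (real m * d) ^ k j)) =
        (real m ^ (k j - 1) * ?q (x j)) / (real m ^ (k j - 1) * (1 - ?q (x j)))"
      unfolding fit_rate_scaled[OF m1 k] kx by (simp only: right_diff_distrib mult_1_right)
    also have "\<dots> = ?q (x j) / (1 - ?q (x j))"
      using m1 by simp
    finally show "((1 + d * (real m - 1)) ^ k j - (1 - 1 / real m) * (real m * d) ^ k j) /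
        (real m ^ (k j - 1) - (1 + d * (real m - 1)) ^ k j + (1 - 1 / real m) * (real m * d) ^ k j) =
        ?q (x j) / (1 - ?q (x j))"
      by (simp only: diff_diff_eq2 diff_add_eq)
  qed
  also have "\<dots> = ?P"
    unfolding R by (simp only: prod.reindex[OF inj'] o_def)
  finally have P: "(\<Prod>j\<in>{s+1..r}.
        ((1 + d * (real m - 1)) ^ k j - (1 - 1 / real m) * (real m * d) ^ k j) /
        (real m ^ (k j - 1) - (1 + d * (real m - 1)) ^ k j + (1 - 1 / real m) * (real m * d) ^ k j)) = ?P" .
  \<comment> \<open>Positivity of the rates enters here: the limit can be divided by itself, which
    turns convergence into asymptotic equivalence.\<close>
  have "?P \<noteq> 0"
    using q by (auto simp: less_imp_neq[symmetric])
  have "((\<lambda>n. mean_occurrences TYPE('a) p n d / (real n ^ Suc s / fact (Suc s)) / ?P) \<longlongrightarrow> ?P / ?P)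
      (inf sequentially (principal {n. d * real n \<in> \<int>}))"
    using mean_occurrences_tendsto[of d p, where 'a = 'a] d m2 \<open>?P \<noteq> 0\<close>
    unfolding m s by (intro tendsto_divide tendsto_const) auto
  then show ?thesis
    unfolding P using \<open>?P \<noteq> 0\<close> by (intro asymp_equivI') simp
qed

end
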